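(* Let $W$ denote an irreducible $\mathcal{H}$-module of type $(\alpha,\beta,\rho)$. Then for $\alpha\leq i\leq k-\rho-\alpha$ and $\rho+\beta\leq j\leq h-\beta$, the subspace $E^{*}_{i,j}W$ is invariant under each of $\mathcal{Y}, \mathcal{P}, \Omega, G, G^*$. Writing $\ell=i+j$, the corresponding eigenvalues on $E^*_{i,j}W$ are: - $\mathcal{Y}$: $\ q^{h+k-\ell}+q^{\ell}-1+q^{-1}$; - $\mathcal{P}$: $\ q(q-1)^{-2}\Bigl(\bigl(q^{h+k-\ell}+q^{\ell}-1+q^{-1}\bigr)^2-q^{h+k-2}(q+1)^2\Bigr)$; - $\Omega$: $\ -\bigl(q^{h+k-\rho-\beta}+q^{k+\beta-1}+q^{k+\ell-\rho-\alpha}+q^{\ell+\alpha-1}\bigr)$; - $G$: $\ (q-1)^{-1}\Bigl(\bigl(q^{k-\rho-\alpha+1}+q^{\alpha}\bigr)\bigl(q^{\ell-1}[h+k-\ell]-q^{\ell}[\ell]\bigr)-\bigl(q^{h-\rho-\beta+1}+q^{\beta}\bigr)\bigl(q^k[h+k-\ell]-q^{k-1}[\ell]\bigr)\Bigr)$; - $G^*$: $\ q^{k+\ell-\rho-1}(q+1)$.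
   Context: Let $h>k\geq 1$ be integers, $\mathbb{F}_q$ a finite field with $q$ elements, $\mathcal{V}$ an $(h+k)$-dimensional vector space over $\mathbb{F}_q$, and $P$ the set of all subspaces of $\mathcal{V}$. Fix $y\in P$ with $\dim y=k$. $\mathrm{Mat}_P(\mathbb{C})$ is the algebra of complex matrices with rows and columns indexed by $P$, acting by left multiplication on the space $V$ of complex column vectors indexed by $P$; $I$ is the identity; $q^{1/2}$ is the positive square root; $[m]=\frac{q^m-1}{q-1}$ for $m\in\mathbb{Z}$. For $0\le i\le k$, $0\le j\le h$ let $P_{i,j}=\{u\in P\mid \dim(u\cap y)=i,\ \dim u=i+j\}$ (these sets partition $P$), and let $E^*_{i,j}$ be the diagonal matrix with $(u,u)$-entry $1$ if $u\in P_{i,j}$ and $0$ otherwise. For $u,v\in P$, $v$ covers $u$ if $u\subseteq v$ and $\dim v=\dim u+1$. If $v$ covers $u$, then $v$ $/$-covers $u$ if $\dim(v\cap y)=\dim(u\cap y)+1$, and $v$ $\backslash$-covers $u$ if $\dim(v\cap y)=\dim(u\cap y)$. $K_1,K_2$ are the diagonal matrices with $(K_1)_{u,u}=q^{\frac k2-i}$, $(K_2)_{u,u}=q^{j-\frac h2}$ for $u\in P_{i,j}$. $L_1,L_2$ are the $0/1$ matrices with $(L_1)_{u,v}=1$ iff $v$ $/$-covers $u$, $(L_2)_{u,v}=1$ iff $v$ $\backslash$-covers $u$; $R_1=L_1^t$, $R_2=L_2^t$. $\mathcal{H}$ is the subalgebra of $\mathrm{Mat}_P(\mathbb{C})$ generated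 by $L_1,L_2,R_1,R_2,K_1^{\pm1},K_2^{\pm1}$. An irreducible $\mathcal{H}$-module is an irreducible $\mathcal{H}$-submodule $W$ of $V$. For each such $W$ it is known (Watanabe) that there exist integers $\alpha,\beta,\rho$ with $0\le\rho$, $0\le\alpha\le\frac{k-\rho}2$, $0\le\beta\le\frac{h-\rho}2$ such that for $0\le i\le k$, $0\le j\le h$, $\dim E^*_{i,j}W=1$ if $\alpha\le i\le k-\rho-\alpha$ and $\rho+\beta\le j\le h-\beta$, and $\dim E^*_{i,j}W=0$ otherwise; $(\alpha,\beta,\rho)$ is called the type of $W$. $F^0,F^+,F^-$ are the $0/1$ matrices such that: $(F^0)_{u,v}=1$ iff $u+v$ $/$-covers both $u$ and $v$, and both $u$ and $v$ $\backslash$-cover $u\cap v$; $(F^+)_{u,v}=1$ iff $u+v$ $\backslash$-covers both $u$ and $v$; $(F^-)_{u,v}=1$ iff both $u$ and $v$ $/$-cover $u\cap v$. Define $$\Omega_0=q^{-\frac{h+k}{2}}\Bigl((q-1)F^{0}K_1^{-1}K_2^{-1}+q^{\frac{h}{2}}K_1^{-1}+q^{\frac{k}{2}}K_2^{-1}-K_1^{-1}K_2^{-1}\Bigr),$$ $$\Omega_1=q^{-\frac{h}{2}}\Bigl(qF^{0}K_2^{-1}+(q-1)F^{-}K_2^{-1}+\tfrac{q^{\frac{k}{2}+1}K_1K_2^{-1}+q^{\frac{h+k}{2}+1}K_1^{-1}-qK_2^{-1}}{q-1}\Bigr)-\tfrac{q}{q-1}I,$$ $$\Omega_2=q^{-\frac{k}{2}}\Bigl(qF^0K_1^{-1}+(q-1)F^{+}K_1^{-1}+\tfrac{q^{\frac{h}{2}+1}K_1^{-1}K_2+q^{\frac{h+k}{2}+1}K_2^{-1}-qK_1^{-1}}{q-1}\Bigr)-\tfrac{q}{q-1}I,$$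 and $$\mathcal{Y}=q^{\frac{h+k}{2}}\bigl(K_1K_2^{-1}+K_1^{-1}K_2\bigr)-q^{-1}(q-1)I,\qquad \mathcal{P}=q(q-1)^{-2}\Bigl(\mathcal{Y}^2-q^{h+k-2}(q+1)^2I\Bigr),$$ $$\Omega=-q^{\frac{h+k}{2}-1}K_1^{-1}K_2\Bigl((q-1)\Omega_1+(q+1)I\Bigr)-q^{k-1}\Bigl((q-1)\Omega_2+(q+1)I\Bigr),$$ $$\begin{aligned}G=&-(q-1)^{-1}\biggl(q^{\frac{h+k}{2}-1}\Bigl(qK_1^{-1}K_2\mathcal{Y}-q^{\frac{h+k}{2}}(q+1)I\Bigr)\Omega_1+q^{k-1}\Bigl(q\mathcal{Y}-q^{\frac{h+k}{2}}(q+1)K_1^{-1}K_2\Bigr)\Omega_2\biggr)\\&-(q+1)(q-1)^{-2}\biggl(\Bigl(q^{\frac{h+k}{2}}K_1^{-1}K_2+q^k I\Bigr)\mathcal{Y}-q^{\frac{h+k}{2}-1}(q+1)\Bigl(q^{k}K_1^{-1}K_2+q^{\frac{h+k}{2}}I\Bigr)\biggr),\end{aligned}$$ $$G^*=q^{\frac{h+3k}{2}-1}(q+1)\Omega_0K_1^{-1}K_2.$$ *)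

theory Defs
  imports "HOL-Analysis.Analysis"
begin

text \<open>
  The ambient space is an abstract vector space \<open>UNIV :: 'v set\<close> over the finite field \<open>'f\<close>.
  A finite-dimensional vector space over a finite field is finite, so requiring \<open>'v\<close> to be of
  class \<open>finite\<close> loses nothing, and it makes \<open>'v set\<close> available as an index type of matrices.

  Matrices with rows and columns indexed by the set \<open>P\<close> of subspaces are represented as matrices
  indexed by all of \<open>'v set\<close> whose entries outside \<open>P \<times> P\<close> vanish, and column vectors indexed by
  \<open>P\<close> as vectors vanishing outside \<open>P\<close>.  Sums, products and the action on vectors are then the
  library ones; the identity of the matrix algebra is \<open>Id_P\<close>, not \<open>mat 1\<close>.
\<close>

locale fixed_subspace = vector_space scale
  for scale :: "'f::{field,finite} \<Rightarrow> 'v::{ab_group_add,finite} \<Rightarrow> 'v" +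
  fixes q :: real and y :: "'v set" and h k :: nat
  assumes q_eq: "q = real CARD('f)"
    and k_ge_1: "1 \<le> k" and k_less_h: "k < h"
    and dim_UNIV: "dim (UNIV :: 'v set) = h + k"
    and subspace_y: "subspace y" and dim_y: "dim y = k"
begin

definition P :: "'v set set" where "P = {u. subspace u}"

definition P_part :: "nat \<Rightarrow> nat \<Rightarrow> 'v set set" where
  "P_part i j = {u \<in> P. dim (u \<inter> y) = i \<and> dim u = i + j}"

definition sub_sum :: "'v set \<Rightarrow> 'v set \<Rightarrow> 'v set" where
  "sub_sum u v = {a + b | a b. a \<in> u \<and> b \<in> v}"

text \<open>In the covering relations, \<open>covers v u\<close> reads ``\<open>v\<close> covers \<open>u\<close>''.\<close>

definition covers :: "'v set \<Rightarrow> 'v set \<Rightarrow> bool" where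
  "covers v u \<longleftrightarrow> u \<in> P \<and> v \<in> P \<and> u \<subseteq> v \<and> dim v = dim u + 1"

definition slash_covers :: "'v set \<Rightarrow> 'v set \<Rightarrow> bool" where
  "slash_covers v u \<longleftrightarrow> covers v u \<and> dim (v \<inter> y) = dim (u \<inter> y) + 1"

definition backslash_covers :: "'v set \<Rightarrow> 'v set \<Rightarrow> bool" where
  "backslash_covers v u \<longleftrightarrow> covers v u \<and> dim (v \<inter> y) = dim (u \<inter> y)"

definition rel_mat :: "('v set \<Rightarrow> 'v set \<Rightarrow> bool) \<Rightarrow> complex^'v set^'v set" where
  "rel_mat r = (\<chi> u v. if u \<in> P \<and> v \<in> P \<and> r u v then 1 else 0)"

definition diag_P :: "('v set \<Rightarrow> real) \<Rightarrow> complex^'v set^'v set" where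
  "diag_P d = (\<chi> u v. if u \<in> P \<and> u = v then complex_of_real (d u) else 0)"

definition Id_P :: "complex^'v set^'v set" where
  "Id_P = diag_P (\<lambda>u. 1)"

definition Estar :: "nat \<Rightarrow> nat \<Rightarrow> complex^'v set^'v set" where
  "Estar i j = diag_P (\<lambda>u. if u \<in> P_part i j then 1 else 0)"

text \<open>
  For \<open>u \<in> P_part i j\<close> one has \<open>i = dim (u \<inter> y)\<close> and \<open>j = dim u - dim (u \<inter> y)\<close>.  The inverses
  below are inverses with respect to \<open>Id_P\<close>.
\<close>

definition wt1 :: "'v set \<Rightarrow> real" where
  "wt1 u = q powr (real k / 2 - real (dim (u \<inter> y)))"

definition wt2 :: "'v set \<Rightarrow> real" where
  "wt2 u = q powr ((real (dim u) - real (dim (u \<inter> y))) - real h / 2)"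

definition K1 :: "complex^'v set^'v set" where "K1 = diag_P wt1"
definition K2 :: "complex^'v set^'v set" where "K2 = diag_P wt2"
definition K1inv :: "complex^'v set^'v set" where "K1inv = diag_P (\<lambda>u. inverse (wt1 u))"
definition K2inv :: "complex^'v set^'v set" where "K2inv = diag_P (\<lambda>u. inverse (wt2 u))"

definition L1 :: "complex^'v set^'v set" where
  "L1 = rel_mat (\<lambda>u v. slash_covers v u)"

definition L2 :: "complex^'v set^'v set" where
  "L2 = rel_mat (\<lambda>u v. backslash_covers v u)"

definition R1 :: "complex^'v set^'v set" where "R1 = transpose L1"
definition R2 :: "complex^'v set^'v set" where "R2 = transpose L2"

text \<open>\<open>mat c ** A\<close> is the scalar multiple of \<open>A\<close> by the complex number \<open>c\<close>.  The algebra
  contains \<open>Id_P = K1 ** K1inv\<close>.\<close>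

inductive_set algH :: "(complex^'v set^'v set) set" where
  gen: "A \<in> {L1, L2, R1, R2, K1, K1inv, K2, K2inv} \<Longrightarrow> A \<in> algH"
| add: "A \<in> algH \<Longrightarrow> B \<in> algH \<Longrightarrow> A + B \<in> algH"
| smult: "A \<in> algH \<Longrightarrow> mat c ** A \<in> algH"
| mult: "A \<in> algH \<Longrightarrow> B \<in> algH \<Longrightarrow> A ** B \<in> algH"

definition V :: "(complex^'v set) set" where
  "V = {x. \<forall>u. u \<notin> P \<longrightarrow> x $ u = 0}"

definition H_submodule :: "(complex^'v set) set \<Rightarrow> bool" where
  "H_submodule W \<longleftrightarrow> vec.subspace W \<and> W \<subseteq> V \<and> (\<forall>A\<in>algH. \<forall>w\<in>W. A *v w \<in> W)"

definition irreducible_H_module :: "(complex^'v set) set \<Rightarrow> bool" where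
  "irreducible_H_module W \<longleftrightarrow> H_submodule W \<and> W \<noteq> {0} \<and>
     (\<forall>W'. H_submodule W' \<and> W' \<subseteq> W \<longrightarrow> W' = {0} \<or> W' = W)"

definition Estar_image :: "nat \<Rightarrow> nat \<Rightarrow> (complex^'v set) set \<Rightarrow> (complex^'v set) set" where
  "Estar_image i j W = (\<lambda>w. Estar i j *v w) ` W"

text \<open>The bounds \<open>\<alpha> \<le> (k - \<rho>) / 2\<close> and \<open>\<beta> \<le> (h - \<rho>) / 2\<close> are written without division; they
  ensure that the truncated differences below are genuine ones.\<close>

definition has_type :: "(complex^'v set) set \<Rightarrow> nat \<Rightarrow> nat \<Rightarrow> nat \<Rightarrow> bool" where
  "has_type W \<alpha> \<beta> \<rho> \<longleftrightarrow> \<rho> + 2 * \<alpha> \<le> k \<and> \<rho> + 2 * \<beta> \<le> h \<and>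
     (\<forall>i\<le>k. \<forall>j\<le>h. vec.dim (Estar_image i j W) =
        (if \<alpha> \<le> i \<and> i \<le> k - \<rho> - \<alpha> \<and> \<rho> + \<beta> \<le> j \<and> j \<le> h - \<beta> then 1 else 0))"

definition F0 :: "complex^'v set^'v set" where
  "F0 = rel_mat (\<lambda>u v.
     slash_covers (sub_sum u v) u \<and> slash_covers (sub_sum u v) v \<and>
     backslash_covers u (u \<inter> v) \<and> backslash_covers v (u \<inter> v))"

definition Fplus :: "complex^'v set^'v set" where
  "Fplus = rel_mat (\<lambda>u v.
     backslash_covers (sub_sum u v) u \<and> backslash_covers (sub_sum u v) v)"

definition Fminus :: "complex^'v set^'v set" where
  "Fminus = rel_mat (\<lambda>u v. slash_covers u (u \<inter> v) \<and> slash_covers v (u \<inter> v))"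

definition Omega0 :: "complex^'v set^'v set" where
  "Omega0 = q powr (- (real h + real k) / 2) *\<^sub>R
     ((q - 1) *\<^sub>R (F0 ** K1inv ** K2inv) + q powr (real h / 2) *\<^sub>R K1inv
      + q powr (real k / 2) *\<^sub>R K2inv - K1inv ** K2inv)"

definition Omega1 :: "complex^'v set^'v set" where
  "Omega1 = q powr (- real h / 2) *\<^sub>R
     (q *\<^sub>R (F0 ** K2inv) + (q - 1) *\<^sub>R (Fminus ** K2inv)
      + (1 / (q - 1)) *\<^sub>R
          (q powr (real k / 2 + 1) *\<^sub>R (K1 ** K2inv)
           + q powr ((real h + real k) / 2 + 1) *\<^sub>R K1inv
           - q *\<^sub>R K2inv))
     - (q / (q - 1)) *\<^sub>R Id_P"

definition Omega2 :: "complex^'v set^'v set" where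
  "Omega2 = q powr (- real k / 2) *\<^sub>R
     (q *\<^sub>R (F0 ** K1inv) + (q - 1) *\<^sub>R (Fplus ** K1inv)
      + (1 / (q - 1)) *\<^sub>R
          (q powr (real h / 2 + 1) *\<^sub>R (K1inv ** K2)
           + q powr ((real h + real k) / 2 + 1) *\<^sub>R K2inv
           - q *\<^sub>R K1inv))
     - (q / (q - 1)) *\<^sub>R Id_P"

definition Ymat :: "complex^'v set^'v set" where
  "Ymat = q powr ((real h + real k) / 2) *\<^sub>R (K1 ** K2inv + K1inv ** K2)
     - (q powr (-1) * (q - 1)) *\<^sub>R Id_P"

definition Pmat :: "complex^'v set^'v set" where
  "Pmat = (q * (q - 1) powr (-2)) *\<^sub>R
     (Ymat ** Ymat - (q powr (real h + real k - 2) * (q + 1)\<^sup>2) *\<^sub>R Id_P)"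

definition Omega :: "complex^'v set^'v set" where
  "Omega =
     - (q powr ((real h + real k) / 2 - 1) *\<^sub>R
          (K1inv ** K2 ** ((q - 1) *\<^sub>R Omega1 + (q + 1) *\<^sub>R Id_P)))
     - q powr (real k - 1) *\<^sub>R ((q - 1) *\<^sub>R Omega2 + (q + 1) *\<^sub>R Id_P)"

definition G :: "complex^'v set^'v set" where
  "G =
     - ((1 / (q - 1)) *\<^sub>R
         (q powr ((real h + real k) / 2 - 1) *\<^sub>R
            ((q *\<^sub>R (K1inv ** K2 ** Ymat)
              - (q powr ((real h + real k) / 2) * (q + 1)) *\<^sub>R Id_P) ** Omega1)
          + q powr (real k - 1) *\<^sub>R
            ((q *\<^sub>R Ymat
              - (q powr ((real h + real k) / 2) * (q + 1)) *\<^sub>R (K1inv ** K2)) ** Omega2)))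
     - ((q + 1) * (q - 1) powr (-2)) *\<^sub>R
         ((q powr ((real h + real k) / 2) *\<^sub>R (K1inv ** K2) + q powr real k *\<^sub>R Id_P) ** Ymat
          - (q powr ((real h + real k) / 2 - 1) * (q + 1)) *\<^sub>R
              (q powr real k *\<^sub>R (K1inv ** K2)
               + q powr ((real h + real k) / 2) *\<^sub>R Id_P))"

definition Gstar :: "complex^'v set^'v set" where
  "Gstar = (q powr ((real h + 3 * real k) / 2 - 1) * (q + 1)) *\<^sub>R (Omega0 ** K1inv ** K2)"

end

definition qint :: "real \<Rightarrow> int \<Rightarrow> real" where
  "qint q m = (q powr real_of_int m - 1) / (q - 1)"

definition invariant_with_eigenvalue ::
    "complex^'n^'n \<Rightarrow> (complex^'n) set \<Rightarrow> real \<Rightarrow> bool" where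
  "invariant_with_eigenvalue A S \<theta> \<longleftrightarrow>
     (\<forall>w\<in>S. A *v w \<in> S) \<and> (\<forall>w\<in>S. A *v w = complex_of_real \<theta> *s w)"

end

theory Submission
  imports Defs
begin

text \<open>
  On a block \<open>P_part i j\<close> the matrices \<open>K1\<close> and \<open>K2\<close> are scalars, so all five eigenvalues come down
  to the scalars by which \<open>F0\<close>, \<open>Fminus\<close> and \<open>Fplus\<close> act on the weight space of \<open>W\<close> at \<open>(i, j)\<close>.
  These are found as in the representation theory of \<open>sl\<^sub>2\<close>, by walking along rows and columns of
  the rectangle that is described by the type.

  Counting common covers and commonly covered subspaces expresses the three matrices by lowering
  and raising.  Up to diagonal matrices, \<open>Fminus\<close> is \<open>R1 L1\<close>, \<open>Fplus\<close> is \<open>L2 R2\<close>, and \<open>F0\<close> is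
  the commutator of \<open>L1\<close> and \<open>R1\<close> as well as the commutator of \<open>R2\<close> and \<open>L2\<close> (\<open>L1_R1\<close>, \<open>R1_L1\<close>,
  \<open>R2_L2\<close>, \<open>L2_R2\<close>).  Matrices of different directions commute up to powers of \<open>q\<close> (\<open>exchange\<close>), so
  the second description of \<open>F0\<close> shows how it commutes with \<open>L1\<close> and \<open>R1\<close>, and the first one how it
  commutes with \<open>L2\<close> and \<open>R2\<close>.  It follows that \<open>Omega0\<close> commutes with the action of the algebra
  (\<open>Omega0_commutes_generators\<close>), and by Schur's lemma it acts on \<open>W\<close> as a scalar
  (\<open>Omega0_scalar\<close>).

  In terms of that scalar the action of \<open>F0\<close> on every weight space is known.  The weight
  spaces are lines, so \<open>R1 L1\<close> at \<open>(i + 1, j)\<close> and \<open>L1 R1\<close> at \<open>(i, j)\<close> are the same scalar, and it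
  vanishes at both ends of a row (\<open>ladder_scalars\<close>).  The increments are the values of the commutator,
  which are known; that they sum to zero over a row forces the scalar of \<open>Omega0\<close> to be
  \<open>q\<close> to the power \<open>-\<rho>\<close> (\<open>omega0_eq\<close>).  Partial sums along a row then give \<open>Fminus\<close>, and partial sums
  along a column give \<open>Fplus\<close>.  When they are inserted in the definitions, the dependence on the
  block disappears, and \<open>(q - 1) * Omega1 + (q + 1)\<close> and \<open>(q - 1) * Omega2 + (q + 1)\<close> become
  \<open>q\<^sup>a + q\<^sup>\<alpha>\<close> and \<open>q\<^sup>b + q\<^sup>\<beta>\<close> with \<open>a = k - \<rho> - \<alpha> + 1\<close> and \<open>b = h - \<rho> - \<beta> + 1\<close> (\<open>acts_Omega1\<close>,
  \<open>acts_Omega2\<close>).  The stated eigenvalues follow by substitution.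
\<close>

section \<open>Counting subspaces over a finite field\<close>

lemma eq_geometric_sum_if_mult_eq:
  fixes Q c n d :: nat
  assumes Q: "2 \<le> Q" and eq: "c * (Q ^ Suc n - Q ^ n) = Q ^ (n + d) - Q ^ n"
  shows "c = (\<Sum>m<d. Q ^ m)"
proof -
  have "Q ^ n \<le> Q ^ Suc n" "Q ^ n \<le> Q ^ (n + d)"
    using Q by (intro power_increasing; simp)+
  then have "int c * (int Q ^ Suc n - int Q ^ n) = int Q ^ (n + d) - int Q ^ n"
    using arg_cong[OF eq, of int] by (simp only: of_nat_mult of_nat_diff of_nat_power)
  then have "int Q ^ n * ((int Q - 1) * int c) = int Q ^ n * (int Q ^ d - 1)"
    by (simp add: algebra_simps power_add)
  moreover have "int Q ^ n \<noteq> 0" using Q by simp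
  ultimately have "(int Q - 1) * int c = int Q ^ d - 1" by (metis mult_cancel_left)
  also have "\<dots> = (int Q - 1) * (\<Sum>m<d. int Q ^ m)" by (rule power_diff_1_eq)
  finally have "int c = (\<Sum>m<d. int Q ^ m)" using Q by simp
  also have "\<dots> = int (\<Sum>m<d. Q ^ m)" by simp
  finally show ?thesis by (rule of_nat_eq_iff[THEN iffD1])
qed

locale finite_vector_space = vector_space scale
  for scale :: "'f::{field,finite} \<Rightarrow> 'v::{ab_group_add,finite} \<Rightarrow> 'v"
begin

sublocale fd: finite_dimensional_vector_space scale "extend_basis {}"
  by unfold_locales (auto simp: span_extend_basis independent_extend_basis independent_empty)

text \<open>Adjoining a basis vector \<open>a\<close> to \<open>B\<close> multiplies the span by \<open>CARD('f)\<close>: each element of the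
  new span is \<open>c a + x\<close> for exactly one \<open>c\<close> and one \<open>x\<close> in the old span.\<close>

lemma card_span_independent:
  assumes "independent B"
  shows "card (span B) = CARD('f) ^ card B"
proof -
  have "finite B" by simp
  then show ?thesis using assms
  proof (induction B)
    case empty
    then show ?case by simp
  next
    case (insert a B)
    have ind: "independent B" and a: "a \<notin> span B"
      using insert.prems insert.hyps by (auto simp: independent_insert)
    let ?f = "\<lambda>(c, x). scale c a + x"
    have "span (insert a B) = ?f ` (UNIV \<times> span B)"
    proof (intro set_eqI iffI)
      fix x assume "x \<in> span (insert a B)"
      then obtain c where "x - scale c a \<in> span B" by (auto simp: span_insert)
      moreover have "x = ?f (c, x - scale c a)" by simp
      ultimately show "x \<in> ?f ` (UNIV \<times> span B)" by blast
    next
      fix x assume "x \<in> ?f ` (UNIV \<times> span B)"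
      then obtain c z where "x = scale c a + z" "z \<in> span B" by auto
      then have "x - scale c a \<in> span B" by simp
      then show "x \<in> span (insert a B)" by (auto simp: span_insert)
    qed
    moreover have "inj_on ?f (UNIV \<times> span B)"
    proof (rule inj_onI, clarsimp)
      fix c d :: 'f and x z :: 'v
      assume x: "x \<in> span B" and z: "z \<in> span B" and eq: "scale c a + x = scale d a + z"
      have "scale (c - d) a = z - x" using eq by (simp add: scale_left_diff_distrib algebra_simps)
      then have m: "scale (c - d) a \<in> span B" using x z by (simp add: span_diff)
      have "c = d"
      proof (rule ccontr)
        assume "c \<noteq> d"
        then have "a = scale (inverse (c - d)) (scale (c - d) a)" by simp
        moreover have "scale (inverse (c - d)) (scale (c - d) a) \<in> span B" using m by (rule span_scale)
        ultimately show False using a by simp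
      qed
      then show "c = d \<and> x = z" using eq by simp
    qed
    ultimately have "card (span (insert a B)) = CARD('f) * card (span B)"
      by (simp add: card_image card_cartesian_product)
    then show ?case using insert ind by simp
  qed
qed

lemma card_subspace:
  assumes "subspace u"
  shows "card u = CARD('f) ^ dim u"
proof -
  obtain B where "B \<subseteq> u" "independent B" "u \<subseteq> span B" "card B = dim u"
    using basis_exists by blast
  moreover from this have "span B = u" using span_minimal[of B u] assms by blast
  ultimately show ?thesis using card_span_independent[of B] by simp
qed

lemma card_field_ge_2: "2 \<le> CARD('f)"
proof -
  have "card {0, 1 :: 'f} \<le> CARD('f)" by (rule card_mono) auto
  then show ?thesis by simp
qed

lemma subspace_eq_if_dim_eq:
  assumes "subspace u" "subspace v" "u \<subseteq> v" "dim u = dim v"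
  shows "u = v"
  using fd.subspace_dim_equal assms by simp

definition covers_within :: "'v set \<Rightarrow> 'v set \<Rightarrow> 'v set set" where
  "covers_within u v = {w. subspace w \<and> u \<subseteq> w \<and> w \<subseteq> v \<and> dim w = Suc (dim u)}"

definition hyperplanes_over :: "'v set \<Rightarrow> 'v set \<Rightarrow> 'v set set" where
  "hyperplanes_over t u = {w. subspace w \<and> t \<subseteq> w \<and> w \<subseteq> u \<and> Suc (dim w) = dim u}"

lemma cover_eq_span_insert:
  assumes u: "subspace u" and w: "w \<in> covers_within u v" and x: "x \<in> w" "x \<notin> u"
  shows "w = span (insert x u)"
proof -
  have w': "subspace w" "u \<subseteq> w" "dim w = Suc (dim u)" using w by (auto simp: covers_within_def)
  have "x \<notin> span u" using x(2) u span_eq_iff[of u] by blast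
  moreover have "dim (span (insert x u)) = dim (insert x u)" by (rule dim_span)
  ultimately have "dim (span (insert x u)) = dim w"
    using w' by (simp add: fd.dim_insert)
  moreover have "span (insert x u) \<subseteq> w"
    by (rule span_minimal[OF _ w'(1)]) (use x w'(2) in simp)
  ultimately show ?thesis using subspace_eq_if_dim_eq[OF subspace_span w'(1)] by auto
qed

text \<open>The covers of \<open>u\<close> inside \<open>v\<close> cut the complement of \<open>u\<close> in \<open>v\<close> into disjoint
  pieces of equal size, because a vector outside \<open>u\<close> lies in exactly one cover of \<open>u\<close>.\<close>

lemma card_covers_within:
  assumes u: "subspace u" and v: "subspace v" and uv: "u \<subseteq> v"
  shows "card (covers_within u v) = (\<Sum>m<dim v - dim u. CARD('f) ^ m)"
proof -
  let ?C = "covers_within u v" and ?Q = "CARD('f)" and ?n = "dim u" and ?d = "dim v - dim u"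
  have dv: "dim v = ?n + ?d" using fd.dim_subset[OF uv] by simp
  have un: "(\<Union>w\<in>?C. w - u) = v - u"
  proof (intro equalityI subsetI)
    fix x assume "x \<in> (\<Union>w\<in>?C. w - u)"
    then show "x \<in> v - u" by (auto simp: covers_within_def)
  next
    fix x assume x: "x \<in> v - u"
    have "x \<notin> span u" using x u span_eq_iff[of u] by blast
    moreover have "dim (span (insert x u)) = dim (insert x u)" by (rule dim_span)
    ultimately have "dim (span (insert x u)) = Suc ?n" by (simp add: fd.dim_insert)
    moreover have "span (insert x u) \<subseteq> v"
      by (rule span_minimal[OF _ v]) (use x uv in simp)
    moreover have "insert x u \<subseteq> span (insert x u)" by (rule span_superset)
    ultimately have "span (insert x u) \<in> ?C" by (simp add: covers_within_def)
    moreover have "x \<in> span (insert x u)" by (rule span_base) simp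
    ultimately show "x \<in> (\<Union>w\<in>?C. w - u)" using x by blast
  qed
  have "card (v - u) = (\<Sum>w\<in>?C. card (w - u))"
    unfolding un[symmetric]
  proof (rule card_UN_disjoint)
    show "\<forall>w\<in>?C. \<forall>w'\<in>?C. w \<noteq> w' \<longrightarrow> (w - u) \<inter> (w' - u) = {}"
    proof (intro ballI impI equals0I)
      fix w w' x assume "w \<in> ?C" "w' \<in> ?C" "w \<noteq> w'" "x \<in> (w - u) \<inter> (w' - u)"
      then show False using cover_eq_span_insert[OF u, of w v x] cover_eq_span_insert[OF u, of w' v x] by simp
    qed
  qed auto
  also have "\<dots> = (\<Sum>w\<in>?C. ?Q ^ Suc ?n - ?Q ^ ?n)"
  proof (rule sum.cong[OF refl])
    fix w assume "w \<in> ?C"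
    then have w: "subspace w" "u \<subseteq> w" "dim w = Suc ?n" by (auto simp: covers_within_def)
    then show "card (w - u) = ?Q ^ Suc ?n - ?Q ^ ?n"
      using card_subspace[OF w(1)] card_subspace[OF u] by (simp add: card_Diff_subset)
  qed
  finally have "card (v - u) = card ?C * (?Q ^ Suc ?n - ?Q ^ ?n)" by simp
  moreover have "card (v - u) = ?Q ^ (?n + ?d) - ?Q ^ ?n"
    using card_subspace[OF v] card_subspace[OF u] card_Diff_subset[OF finite uv] dv by simp
  ultimately have "card ?C * (?Q ^ Suc ?n - ?Q ^ ?n) = ?Q ^ (?n + ?d) - ?Q ^ ?n" by (rule trans[OF sym])
  then show ?thesis by (rule eq_geometric_sum_if_mult_eq[OF card_field_ge_2])
qed

text \<open>Counting the pairs of a cover \<open>s\<close> of \<open>t\<close> and a hyperplane \<open>w \<supseteq> s\<close> of \<open>u\<close> in both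
  orders reduces the number of hyperplanes over \<open>t\<close> to the number of hyperplanes over \<open>s\<close>,
  without any appeal to duality.\<close>

lemma card_hyperplanes_over:
  assumes "subspace t" and u: "subspace u" and "t \<subseteq> u"
  shows "card (hyperplanes_over t u) = (\<Sum>m<dim u - dim t. CARD('f) ^ m)"
  using assms(1,3)
proof (induction "dim u - dim t" arbitrary: t)
  case 0
  have "w \<notin> hyperplanes_over t u" for w
    using 0(1) fd.dim_subset[of t w] by (auto simp: hyperplanes_over_def)
  then have "hyperplanes_over t u = {}" by blast
  then show ?case using 0(1)[symmetric] by simp
next
  case (Suc d)
  let ?H = "hyperplanes_over t u" and ?C = "covers_within t u"
    and ?N = "\<lambda>n. \<Sum>m<n. CARD('f) ^ m"
  show ?case
  proof (cases "d = 0")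
    case True
    then have "Suc (dim t) = dim u" using Suc.hyps(2) by simp
    moreover from this have "w = t" if "w \<in> ?H" for w
      using that subspace_eq_if_dim_eq[OF Suc.prems(1), of w] by (auto simp: hyperplanes_over_def)
    ultimately have "?H = {t}" using Suc.prems by (auto simp: hyperplanes_over_def)
    then show ?thesis using True Suc.hyps(2)[symmetric] by simp
  next
    case False
    have "?N (Suc d) * ?N d = (\<Sum>s\<in>?C. ?N d)"
      using card_covers_within[OF Suc.prems(1) u Suc.prems(2)] Suc.hyps(2) by simp
    also have "\<dots> = (\<Sum>s\<in>?C. card {w \<in> ?H. s \<subseteq> w})"
    proof (rule sum.cong[OF refl])
      fix s assume "s \<in> ?C"
      then have s: "subspace s" "t \<subseteq> s" "s \<subseteq> u" "dim s = Suc (dim t)"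
        by (auto simp: covers_within_def)
      then have "{w \<in> ?H. s \<subseteq> w} = hyperplanes_over s u" by (auto simp: hyperplanes_over_def)
      moreover have d: "d = dim u - dim s" using Suc.hyps(2) s(4) by simp
      ultimately show "?N d = card {w \<in> ?H. s \<subseteq> w}"
        using Suc.hyps(1)[OF d s(1,3)] d by simp
    qed
    also have "\<dots> = (\<Sum>w\<in>?H. card {s \<in> ?C. s \<subseteq> w})"
      by (rule sum_multicount_gen) auto
    also have "\<dots> = (\<Sum>w\<in>?H. ?N d)"
    proof (rule sum.cong[OF refl])
      fix w assume "w \<in> ?H"
      then have w: "subspace w" "t \<subseteq> w" "w \<subseteq> u" "Suc (dim w) = dim u"
        by (auto simp: hyperplanes_over_def)
      then have "{s \<in> ?C. s \<subseteq> w} = covers_within t w" by (auto simp: covers_within_def)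
      moreover have "dim w - dim t = d" using w Suc.hyps(2) by simp
      ultimately show "card {s \<in> ?C. s \<subseteq> w} = ?N d"
        using card_covers_within[OF Suc.prems(1) w(1,2)] by simp
    qed
    also have "\<dots> = card ?H * ?N d" by simp
    finally have "?N (Suc d) * ?N d = card ?H * ?N d" .
    \<comment> \<open>The common factor vanishes for \<open>d = 0\<close>, which is why that case is treated separately.\<close>
    moreover have "?N d \<noteq> 0" using False card_field_ge_2 by auto
    ultimately have "card ?H = ?N (Suc d)" by (metis mult_cancel_right)
    then show ?thesis using Suc.hyps(2) by simp
  qed
qed

end

section \<open>Covering relations relative to the fixed subspace\<close>

sublocale fixed_subspace \<subseteq> finite_vector_space scale
  by unfold_locales

context fixed_subspace
begin

lemma P_iff: "u \<in> P \<longleftrightarrow> subspace u"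
  by (simp add: P_def)

lemma subspace_sub_sum: "subspace u \<Longrightarrow> subspace v \<Longrightarrow> subspace (sub_sum u v)"
  unfolding sub_sum_def by (rule subspace_sums)

lemma sub_sum_upper1: "subspace v \<Longrightarrow> u \<subseteq> sub_sum u v"
  unfolding sub_sum_def using subspace_0 by force

lemma sub_sum_upper2: "subspace u \<Longrightarrow> v \<subseteq> sub_sum u v"
  unfolding sub_sum_def using subspace_0 by force

lemma sub_sum_least: "subspace w \<Longrightarrow> u \<subseteq> w \<Longrightarrow> v \<subseteq> w \<Longrightarrow> sub_sum u v \<subseteq> w"
  unfolding sub_sum_def using subspace_add by blast

lemma dim_sub_sum_Int:
  "subspace u \<Longrightarrow> subspace v \<Longrightarrow> dim (sub_sum u v) + dim (u \<inter> v) = dim u + dim v"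
  unfolding sub_sum_def by (rule fd.dim_sums_Int)

lemma subspace_Int_y: "subspace u \<Longrightarrow> subspace (u \<inter> y)"
  using subspace_inter subspace_y by blast

text \<open>Intersecting with the fixed subspace raises the dimension by at most one along a cover, so
  every cover is of exactly one of the two kinds.\<close>

lemma covers_dim_Int_y:
  assumes "covers v u"
  shows "dim (v \<inter> y) = dim (u \<inter> y) \<or> dim (v \<inter> y) = dim (u \<inter> y) + 1"
proof -
  have s: "subspace u" "subspace v" "u \<subseteq> v" "dim v = dim u + 1"
    using assms by (auto simp: covers_def P_iff)
  have "sub_sum (v \<inter> y) u \<subseteq> v" by (rule sub_sum_least) (use s in auto)
  then have "dim (sub_sum (v \<inter> y) u) \<le> dim v" by (rule fd.dim_subset)
  moreover have "dim (sub_sum (v \<inter> y) u) + dim (v \<inter> y \<inter> u) = dim (v \<inter> y) + dim u"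
    by (rule dim_sub_sum_Int) (use s subspace_Int_y in auto)
  moreover have "v \<inter> y \<inter> u = u \<inter> y" using s by blast
  ultimately have "dim (v \<inter> y) + dim u \<le> dim v + dim (u \<inter> y)" by simp
  moreover have "dim (u \<inter> y) \<le> dim (v \<inter> y)" by (rule fd.dim_subset) (use s in blast)
  ultimately show ?thesis using s(4) by presburger
qed

lemma backslash_covers_iff_Int_subset:
  assumes c: "covers v u"
  shows "backslash_covers v u \<longleftrightarrow> v \<inter> y \<subseteq> u"
proof -
  have s: "subspace u" "subspace v" "u \<subseteq> v"
    using c by (auto simp: covers_def P_iff)
  have "v \<inter> y \<subseteq> u" if "dim (v \<inter> y) = dim (u \<inter> y)"
    using subspace_eq_if_dim_eq[of "u \<inter> y" "v \<inter> y"] s subspace_Int_y that by auto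
  moreover have "v \<inter> y = u \<inter> y" if "v \<inter> y \<subseteq> u" using that s by blast
  ultimately show ?thesis using c by (auto simp: backslash_covers_def)
qed

text \<open>A cover enlarges the intersection with \<open>y\<close> if and only if it is obtained by adjoining a vector
  of \<open>y\<close>; so these covers are counted inside \<open>u + y\<close>.\<close>

lemma slash_covers_iff_subset_sum:
  assumes c: "covers v u"
  shows "slash_covers v u \<longleftrightarrow> v \<subseteq> sub_sum u y"
proof -
  have s: "subspace u" "subspace v" "u \<subseteq> v" "dim v = dim u + 1"
    using c by (auto simp: covers_def P_iff)
  let ?m = "sub_sum u (v \<inter> y)"
  have "dim ?m + dim (u \<inter> (v \<inter> y)) = dim u + dim (v \<inter> y)"
    by (rule dim_sub_sum_Int) (use s subspace_Int_y in auto)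
  moreover have "u \<inter> (v \<inter> y) = u \<inter> y" using s by blast
  ultimately have d: "dim ?m + dim (u \<inter> y) = dim u + dim (v \<inter> y)" by simp
  have m: "subspace ?m" by (rule subspace_sub_sum) (use s subspace_Int_y in auto)
  have mv: "?m \<subseteq> v" by (rule sub_sum_least) (use s in auto)
  show ?thesis
  proof
    assume "slash_covers v u"
    then have "dim ?m = dim v" using d s by (simp add: slash_covers_def)
    then have "?m = v" using subspace_eq_if_dim_eq[OF m s(2) mv] by simp
    moreover have "?m \<subseteq> sub_sum u y" unfolding sub_sum_def by blast
    ultimately show "v \<subseteq> sub_sum u y" by blast
  next
    assume a: "v \<subseteq> sub_sum u y"
    have "v \<subseteq> ?m"
    proof
      fix x assume x: "x \<in> v"
      then obtain p r where pr: "x = p + r" "p \<in> u" "r \<in> y" using a by (auto simp: sub_sum_def)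
      have "r = x - p" using pr by simp
      then have "r \<in> v" using x pr s subspace_diff[OF s(2)] by blast
      then show "x \<in> ?m" using pr by (auto simp: sub_sum_def)
    qed
    then have "?m = v" using mv by blast
    then show "slash_covers v u" using c d s by (simp add: slash_covers_def)
  qed
qed

text \<open>For distinct \<open>u\<close> and \<open>v\<close> the only candidates for a common cover and for a commonly
  covered subspace are \<open>u + v\<close> and \<open>u \<inter> v\<close>, and by the dimension formula one exists if and only
  if the other does.\<close>

lemma common_cover_eq_sub_sum:
  assumes "covers w u" "covers w v" "u \<noteq> v"
  shows "w = sub_sum u v"
proof -
  have s: "subspace u" "subspace v" "subspace w" "u \<subseteq> w" "v \<subseteq> w" "dim w = dim u + 1" "dim w = dim v + 1"
    using assms by (auto simp: covers_def P_iff)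
  have l: "sub_sum u v \<subseteq> w" by (rule sub_sum_least) (use s in auto)
  have ss: "subspace (sub_sum u v)" by (rule subspace_sub_sum) (use s in auto)
  have "u \<noteq> sub_sum u v"
  proof
    assume "u = sub_sum u v"
    then have "v \<subseteq> u" using sub_sum_upper2[OF s(1), of v] by simp
    then show False using subspace_eq_if_dim_eq[of v u] s assms(3) by simp
  qed
  then have "dim (sub_sum u v) \<noteq> dim u"
    using subspace_eq_if_dim_eq[OF s(1) ss sub_sum_upper1[OF s(2)]] by metis
  moreover have "dim u \<le> dim (sub_sum u v)" by (rule fd.dim_subset[OF sub_sum_upper1[OF s(2)]])
  moreover have "dim (sub_sum u v) \<le> dim w" by (rule fd.dim_subset[OF l])
  ultimately have "dim (sub_sum u v) = dim w" using s(6) by presburger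
  then show ?thesis using subspace_eq_if_dim_eq[OF ss s(3) l] by simp
qed

lemma common_covered_eq_Int:
  assumes "covers u w" "covers v w" "u \<noteq> v"
  shows "w = u \<inter> v"
proof -
  have s: "subspace u" "subspace v" "subspace w" "w \<subseteq> u" "w \<subseteq> v" "dim u = dim w + 1" "dim v = dim w + 1"
    using assms by (auto simp: covers_def P_iff)
  have ss: "subspace (u \<inter> v)" using s subspace_inter by blast
  have "u \<inter> v \<noteq> u"
  proof
    assume "u \<inter> v = u"
    then have "u \<subseteq> v" by blast
    then show False using subspace_eq_if_dim_eq[of u v] s assms(3) by simp
  qed
  then have "dim (u \<inter> v) \<noteq> dim u"
    using subspace_eq_if_dim_eq[OF ss s(1)] by blast
  moreover have "dim (u \<inter> v) \<le> dim u" by (rule fd.dim_subset) blast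
  moreover have "dim w \<le> dim (u \<inter> v)" by (rule fd.dim_subset) (use s in blast)
  ultimately have d: "dim w = dim (u \<inter> v)" using s(6) by presburger
  show ?thesis by (rule subspace_eq_if_dim_eq[OF s(3) ss _ d]) (use s(4,5) in blast)
qed

text \<open>This is adjacency in the Grassmann graph of subspaces of a fixed dimension.\<close>

definition adjacent :: "'v set \<Rightarrow> 'v set \<Rightarrow> bool" where
  "adjacent u v \<longleftrightarrow> u \<in> P \<and> v \<in> P \<and> dim u = dim v \<and> dim u = dim (u \<inter> v) + 1"

lemma adjacent_in_P: "adjacent u v \<Longrightarrow> u \<in> P \<and> v \<in> P"
  by (simp add: adjacent_def)

lemma adjacent_iff_covers_Int:
  "adjacent u v \<longleftrightarrow> covers u (u \<inter> v) \<and> covers v (u \<inter> v)"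
proof
  assume a: "adjacent u v"
  then have "subspace (u \<inter> v)" by (intro subspace_inter) (simp_all add: adjacent_def P_iff)
  then show "covers u (u \<inter> v) \<and> covers v (u \<inter> v)"
    using a by (simp add: adjacent_def covers_def P_iff)
qed (simp add: adjacent_def covers_def)

lemma adjacent_iff_sub_sum_covers:
  assumes "u \<in> P" "v \<in> P"
  shows "adjacent u v \<longleftrightarrow> covers (sub_sum u v) u \<and> covers (sub_sum u v) v"
proof -
  have s: "subspace u" "subspace v" using assms by (simp_all add: P_iff)
  have "(dim u = dim v \<and> dim u = dim (u \<inter> v) + 1) \<longleftrightarrow>
      (dim (sub_sum u v) = dim u + 1 \<and> dim (sub_sum u v) = dim v + 1)"
    using dim_sub_sum_Int[OF s] by presburger
  then show ?thesis
    using s subspace_sub_sum[OF s] sub_sum_upper1[OF s(2)] sub_sum_upper2[OF s(1)]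
    by (simp add: adjacent_def covers_def P_iff)
qed

text \<open>Inside the interval from \<open>u \<inter> v\<close> to \<open>u + v\<close>, the dimensions of the intersections with the
  fixed subspace are supermodular; together with the two kinds of covers this leaves five
  patterns, three of which are the relations of \<open>Fplus\<close>, \<open>F0\<close> and \<open>Fminus\<close>.\<close>

lemma adjacent_patterns:
  assumes a: "adjacent u v"
  defines "m \<equiv> dim (u \<inter> v \<inter> y)"
  shows "(dim (u \<inter> y), dim (v \<inter> y), dim (sub_sum u v \<inter> y)) \<in>
    {(m, m, m), (m, m, m + 1), (m, m + 1, m + 1), (m + 1, m, m + 1), (m + 1, m + 1, m + 2)}"
proof -
  have s: "subspace u" "subspace v" using a by (auto simp: adjacent_def P_iff)
  have P: "u \<in> P" "v \<in> P" using a by (auto simp: adjacent_def)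
  have c: "covers u (u \<inter> v)" "covers v (u \<inter> v)" using a adjacent_iff_covers_Int by auto
  have d: "covers (sub_sum u v) u" "covers (sub_sum u v) v"
    using a adjacent_iff_sub_sum_covers[OF P] by auto
  have "sub_sum (u \<inter> y) (v \<inter> y) \<subseteq> sub_sum u v \<inter> y"
  proof (rule sub_sum_least)
    show "subspace (sub_sum u v \<inter> y)" using s subspace_sub_sum subspace_Int_y by blast
  qed (use sub_sum_upper1[OF s(2)] sub_sum_upper2[OF s(1)] in blast)+
  then have "dim (sub_sum (u \<inter> y) (v \<inter> y)) \<le> dim (sub_sum u v \<inter> y)" by (rule fd.dim_subset)
  moreover have "dim (sub_sum (u \<inter> y) (v \<inter> y)) + dim (u \<inter> y \<inter> (v \<inter> y)) = dim (u \<inter> y) + dim (v \<inter> y)"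
    by (rule dim_sub_sum_Int) (use s subspace_Int_y in auto)
  moreover have "u \<inter> y \<inter> (v \<inter> y) = u \<inter> v \<inter> y" by blast
  ultimately have "dim (u \<inter> y) + dim (v \<inter> y) \<le> dim (sub_sum u v \<inter> y) + m" by (simp add: m_def)
  moreover have "dim (u \<inter> y) = m \<or> dim (u \<inter> y) = m + 1" "dim (v \<inter> y) = m \<or> dim (v \<inter> y) = m + 1"
    using covers_dim_Int_y[OF c(1)] covers_dim_Int_y[OF c(2)] by (simp_all add: m_def)
  moreover note covers_dim_Int_y[OF d(1)] covers_dim_Int_y[OF d(2)]
  moreover have "(b, c, d) \<in> {(m, m, m), (m, m, m + 1), (m, m + 1, m + 1), (m + 1, m, m + 1), (m + 1, m + 1, m + 2)}"
    if "b + c \<le> d + m" "b = m \<or> b = m + 1" "c = m \<or> c = m + 1" "d = b \<or> d = b + 1" "d = c \<or> d = c + 1"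
    for b c d m :: nat
    using that by auto
  ultimately show ?thesis by blast
qed

lemma adjacent_cases:
  assumes "adjacent u v"
  obtains m where "dim (u \<inter> v \<inter> y) = m" "dim (u \<inter> y) = m" "dim (v \<inter> y) = m" "dim (sub_sum u v \<inter> y) = m"
    | m where "dim (u \<inter> v \<inter> y) = m" "dim (u \<inter> y) = m" "dim (v \<inter> y) = m" "dim (sub_sum u v \<inter> y) = Suc m"
    | m where "dim (u \<inter> v \<inter> y) = m" "dim (u \<inter> y) = m" "dim (v \<inter> y) = Suc m" "dim (sub_sum u v \<inter> y) = Suc m"
    | m where "dim (u \<inter> v \<inter> y) = m" "dim (u \<inter> y) = Suc m" "dim (v \<inter> y) = m" "dim (sub_sum u v \<inter> y) = Suc m"
    | m where "dim (u \<inter> v \<inter> y) = m" "dim (u \<inter> y) = Suc m" "dim (v \<inter> y) = Suc m" "dim (sub_sum u v \<inter> y) = Suc (Suc m)"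
  using adjacent_patterns[OF assms] by (elim insertE emptyE Pair_inject; simp)

end

section \<open>The adjacency matrices in terms of lowering and raising\<close>

context fixed_subspace
begin

lemma q_ge_2: "2 \<le> q"
  using card_field_ge_2 by (simp add: q_eq)

text \<open>The bracket \<open>[n]\<close> for natural numbers, a version of \<^const>\<open>qint\<close> without real exponents.\<close>

definition qnum :: "nat \<Rightarrow> real" where
  "qnum n = (q ^ n - 1) / (q - 1)"

lemma qnum_eq_geometric_sum: "real (\<Sum>m<n. CARD('f) ^ m) = qnum n"
  using q_ge_2 by (simp add: qnum_def q_eq[symmetric] geometric_sum)

lemma card_slash_up:
  assumes "u \<in> P"
  shows "real (card {w \<in> P. slash_covers w u}) = qnum (k - dim (u \<inter> y))"
proof -
  have u: "subspace u" using assms by (simp add: P_iff)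
  have "{w \<in> P. slash_covers w u} = {w \<in> P. covers w u \<and> w \<subseteq> sub_sum u y}"
    using slash_covers_iff_subset_sum by (auto simp: slash_covers_def)
  also have "\<dots> = covers_within u (sub_sum u y)"
    using u by (auto simp: covers_def covers_within_def P_iff)
  finally have "card {w \<in> P. slash_covers w u} = (\<Sum>m<dim (sub_sum u y) - dim u. CARD('f) ^ m)"
    using card_covers_within[OF u subspace_sub_sum[OF u subspace_y] sub_sum_upper1[OF subspace_y]]
    by simp
  moreover have "dim (sub_sum u y) - dim u = k - dim (u \<inter> y)"
    using dim_sub_sum_Int[OF u subspace_y] dim_y by presburger
  ultimately show ?thesis using qnum_eq_geometric_sum by presburger
qed

lemma card_up:
  assumes "u \<in> P"
  shows "real (card {w \<in> P. covers w u}) = qnum (h + k - dim u)"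
proof -
  have u: "subspace u" using assms by (simp add: P_iff)
  have "{w \<in> P. covers w u} = covers_within u UNIV"
    using u by (auto simp: covers_def covers_within_def P_iff)
  then show ?thesis
    using card_covers_within[OF u subspace_UNIV] qnum_eq_geometric_sum dim_UNIV by simp
qed

lemma card_backslash_down:
  assumes "u \<in> P"
  shows "real (card {w \<in> P. backslash_covers u w}) = qnum (dim u - dim (u \<inter> y))"
proof -
  have u: "subspace u" using assms by (simp add: P_iff)
  have "{w \<in> P. backslash_covers u w} = {w \<in> P. covers u w \<and> u \<inter> y \<subseteq> w}"
    using backslash_covers_iff_Int_subset by (auto simp: backslash_covers_def)
  also have "\<dots> = hyperplanes_over (u \<inter> y) u"
    using u by (auto simp: covers_def hyperplanes_over_def P_iff)
  finally show ?thesis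
    using card_hyperplanes_over[OF subspace_Int_y[OF u] u] qnum_eq_geometric_sum by simp
qed

lemma card_down:
  assumes "u \<in> P"
  shows "real (card {w \<in> P. covers u w}) = qnum (dim u)"
proof -
  have u: "subspace u" using assms by (simp add: P_iff)
  have "{w \<in> P. covers u w} = hyperplanes_over {0} u"
    using u subspace_0 by (auto simp: covers_def hyperplanes_over_def P_iff)
  moreover have "{0} \<subseteq> u" using subspace_0[OF u] by simp
  ultimately show ?thesis
    using card_hyperplanes_over[OF subspace_single_0 u] qnum_eq_geometric_sum by simp
qed

lemma card_split_cover_kinds:
  "card {w \<in> P. covers w u} = card {w \<in> P. slash_covers w u} + card {w \<in> P. backslash_covers w u}"
  "card {w \<in> P. covers u w} = card {w \<in> P. slash_covers u w} + card {w \<in> P. backslash_covers u w}"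
proof -
  have "{w \<in> P. covers w u} = {w \<in> P. slash_covers w u} \<union> {w \<in> P. backslash_covers w u}"
    "{w \<in> P. covers u w} = {w \<in> P. slash_covers u w} \<union> {w \<in> P. backslash_covers u w}"
    using covers_dim_Int_y by (auto simp: slash_covers_def backslash_covers_def)
  moreover have "{w \<in> P. slash_covers w u} \<inter> {w \<in> P. backslash_covers w u} = {}"
    "{w \<in> P. slash_covers u w} \<inter> {w \<in> P. backslash_covers u w} = {}"
    by (auto simp: slash_covers_def backslash_covers_def)
  ultimately show
    "card {w \<in> P. covers w u} = card {w \<in> P. slash_covers w u} + card {w \<in> P. backslash_covers w u}"
    "card {w \<in> P. covers u w} = card {w \<in> P. slash_covers u w} + card {w \<in> P. backslash_covers u w}"
    by (simp_all add: card_Un_disjoint)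
qed

lemma card_common_covers:
  assumes "u \<in> P" "v \<in> P" "u \<noteq> v"
  shows "card {w \<in> P. covers w u \<and> covers w v \<and> X w} = of_bool (adjacent u v \<and> X (sub_sum u v))"
proof -
  have "sub_sum u v \<in> P" using assms subspace_sub_sum by (simp add: P_iff)
  then have "w \<in> P \<and> covers w u \<and> covers w v \<and> X w \<longleftrightarrow> w = sub_sum u v \<and> adjacent u v \<and> X (sub_sum u v)" for w
    using common_cover_eq_sub_sum[OF _ _ assms(3), of w] adjacent_iff_sub_sum_covers[OF assms(1,2)] by blast
  then show ?thesis by (cases "adjacent u v \<and> X (sub_sum u v)") auto
qed

lemma card_common_covered:
  assumes "u \<in> P" "v \<in> P" "u \<noteq> v"
  shows "card {w \<in> P. covers u w \<and> covers v w \<and> X w} = of_bool (adjacent u v \<and> X (u \<inter> v))"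
proof -
  have "u \<inter> v \<in> P" using assms subspace_inter by (simp add: P_iff)
  then have "w \<in> P \<and> covers u w \<and> covers v w \<and> X w \<longleftrightarrow> w = u \<inter> v \<and> adjacent u v \<and> X (u \<inter> v)" for w
    using common_covered_eq_Int[OF _ _ assms(3), of w] adjacent_iff_covers_Int[of u v] by blast
  then show ?thesis by (cases "adjacent u v \<and> X (u \<inter> v)") auto
qed

lemma rel_mat_entry: "rel_mat r $ u $ v = of_bool (u \<in> P \<and> v \<in> P \<and> r u v)"
  by (simp add: rel_mat_def)

lemma rel_mat_mult_entry:
  "(rel_mat r ** rel_mat s) $ u $ v
    = (if u \<in> P \<and> v \<in> P then of_nat (card {w \<in> P. r u w \<and> s w v}) else 0)"
proof -
  have "(rel_mat r ** rel_mat s) $ u $ v = (\<Sum>w\<in>UNIV. rel_mat r $ u $ w * rel_mat s $ w $ v)"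
    unfolding matrix_matrix_mult_def by simp
  also have "\<dots> = (\<Sum>w\<in>{w \<in> P. r u w \<and> s w v}. if u \<in> P \<and> v \<in> P then 1 else 0)"
    by (rule sum.mono_neutral_cong_right) (auto simp: rel_mat_entry)
  also have "\<dots> = (if u \<in> P \<and> v \<in> P then of_nat (card {w \<in> P. r u w \<and> s w v}) else 0)"
    by simp
  finally show ?thesis .
qed

lemma diag_P_entry: "diag_P d $ u $ v = (if u \<in> P \<and> u = v then complex_of_real (d u) else 0)"
  by (simp add: diag_P_def)

lemma R1_eq_rel_mat: "R1 = rel_mat slash_covers"
  by (auto simp: R1_def L1_def transpose_def rel_mat_def vec_eq_iff)

lemma R2_eq_rel_mat: "R2 = rel_mat backslash_covers"
  by (auto simp: R2_def L2_def transpose_def rel_mat_def vec_eq_iff)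

lemma F0_entry:
  "F0 $ u $ v = of_bool (adjacent u v \<and> dim (sub_sum u v \<inter> y) = dim (u \<inter> y) + 1
      \<and> dim (sub_sum u v \<inter> y) = dim (v \<inter> y) + 1
      \<and> dim (u \<inter> y) = dim (u \<inter> v \<inter> y) \<and> dim (v \<inter> y) = dim (u \<inter> v \<inter> y))"
proof (cases "u \<in> P \<and> v \<in> P")
  case True
  then show ?thesis using adjacent_iff_covers_Int[of u v] adjacent_iff_sub_sum_covers[of u v]
    by (auto simp: F0_def rel_mat_entry slash_covers_def backslash_covers_def)
qed (use adjacent_in_P in \<open>auto simp: F0_def rel_mat_entry\<close>)

lemma Fplus_entry:
  "Fplus $ u $ v = of_bool (adjacent u v \<and> dim (sub_sum u v \<inter> y) = dim (u \<inter> y)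
      \<and> dim (sub_sum u v \<inter> y) = dim (v \<inter> y))"
proof (cases "u \<in> P \<and> v \<in> P")
  case True
  then show ?thesis using adjacent_iff_sub_sum_covers[of u v]
    by (auto simp: Fplus_def rel_mat_entry backslash_covers_def)
qed (use adjacent_in_P in \<open>auto simp: Fplus_def rel_mat_entry\<close>)

lemma Fminus_entry:
  "Fminus $ u $ v = of_bool (adjacent u v \<and> dim (u \<inter> y) = dim (u \<inter> v \<inter> y) + 1
      \<and> dim (v \<inter> y) = dim (u \<inter> v \<inter> y) + 1)"
proof (cases "u \<in> P \<and> v \<in> P")
  case True
  then show ?thesis using adjacent_iff_covers_Int[of u v]
    by (auto simp: Fminus_def rel_mat_entry slash_covers_def)
qed (use adjacent_in_P in \<open>auto simp: Fminus_def rel_mat_entry\<close>)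

lemma not_adjacent_refl: "\<not> adjacent u u"
  by (simp add: adjacent_def)

text \<open>The entry of a product of a lowering and a raising matrix at \<open>(u, v)\<close> counts common covers or
  commonly covered subspaces.  Off the diagonal there is at most one, and the patterns of
  adjacency decide whether it is of the right kind; on the diagonal all covers of one kind are
  counted.\<close>

lemma L1_R1: "L1 ** R1 = F0 + Fminus + diag_P (\<lambda>u. qnum (k - dim (u \<inter> y)))"
proof (unfold vec_eq_iff, intro allI)
  fix u v
  show "(L1 ** R1) $ u $ v = (F0 + Fminus + diag_P (\<lambda>u. qnum (k - dim (u \<inter> y)))) $ u $ v"
  proof (cases "u \<in> P \<and> v \<in> P")
    case P: True
    show ?thesis
    proof (cases "u = v")
      case True
      have "complex_of_real (real (card {w \<in> P. slash_covers w u})) = of_real (qnum (k - dim (u \<inter> y)))"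
        using card_slash_up P by simp
      then show ?thesis using True P
        by (simp add: L1_def R1_eq_rel_mat rel_mat_mult_entry F0_entry Fminus_entry diag_P_entry
            not_adjacent_refl)
    next
      case False
      have "{w \<in> P. slash_covers w u \<and> slash_covers w v} = {w \<in> P. covers w u \<and> covers w v \<and>
          (dim (w \<inter> y) = dim (u \<inter> y) + 1 \<and> dim (w \<inter> y) = dim (v \<inter> y) + 1)}"
        by (auto simp: slash_covers_def)
      then have card: "card {w \<in> P. slash_covers w u \<and> slash_covers w v} = of_bool (adjacent u v \<and>
          (dim (sub_sum u v \<inter> y) = dim (u \<inter> y) + 1 \<and> dim (sub_sum u v \<inter> y) = dim (v \<inter> y) + 1))"
        using card_common_covers[OF _ _ False] P by simp
      have "(L1 ** R1) $ u $ v = F0 $ u $ v + Fminus $ u $ v"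
      proof (cases "adjacent u v")
        case True
        then show ?thesis using P
          by (cases rule: adjacent_cases)
            (simp_all add: L1_def R1_eq_rel_mat rel_mat_mult_entry F0_entry Fminus_entry card)
      qed (simp add: L1_def R1_eq_rel_mat rel_mat_mult_entry F0_entry Fminus_entry card)
      then show ?thesis using False by (simp add: diag_P_entry)
    qed
  next
    case False
    moreover from this have "\<not> adjacent u v" using adjacent_in_P by blast
    ultimately show ?thesis by (auto simp: L1_def R1_eq_rel_mat rel_mat_mult_entry F0_entry Fminus_entry diag_P_entry)
  qed
qed

lemma R1_L1: "R1 ** L1 = Fminus + diag_P (\<lambda>u. qnum (dim u) - qnum (dim u - dim (u \<inter> y)))"
proof (unfold vec_eq_iff, intro allI)
  fix u v
  show "(R1 ** L1) $ u $ v
    = (Fminus + diag_P (\<lambda>u. qnum (dim u) - qnum (dim u - dim (u \<inter> y)))) $ u $ v"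
  proof (cases "u \<in> P \<and> v \<in> P")
    case P: True
    show ?thesis
    proof (cases "u = v")
      case True
      have "real (card {w \<in> P. slash_covers u w}) = qnum (dim u) - qnum (dim u - dim (u \<inter> y))"
        using card_down[of u] card_backslash_down[of u] card_split_cover_kinds(2)[of u] P by simp
      then have "complex_of_real (real (card {w \<in> P. slash_covers u w}))
          = of_real (qnum (dim u) - qnum (dim u - dim (u \<inter> y)))" by (rule arg_cong)
      then show ?thesis using True P
        by (simp add: L1_def R1_eq_rel_mat rel_mat_mult_entry Fminus_entry diag_P_entry
            not_adjacent_refl)
    next
      case False
      have "{w \<in> P. slash_covers u w \<and> slash_covers v w} = {w \<in> P. covers u w \<and> covers v w \<and>
          (dim (u \<inter> y) = dim (w \<inter> y) + 1 \<and> dim (v \<inter> y) = dim (w \<inter> y) + 1)}"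
        by (auto simp: slash_covers_def)
      then have card: "card {w \<in> P. slash_covers u w \<and> slash_covers v w} = of_bool (adjacent u v \<and>
          (dim (u \<inter> y) = dim (u \<inter> v \<inter> y) + 1 \<and> dim (v \<inter> y) = dim (u \<inter> v \<inter> y) + 1))"
        using card_common_covered[OF _ _ False] P by simp
      have "(R1 ** L1) $ u $ v = Fminus $ u $ v"
        using P by (simp add: L1_def R1_eq_rel_mat rel_mat_mult_entry Fminus_entry card)
      then show ?thesis using False by (simp add: diag_P_entry)
    qed
  next
    case False
    moreover from this have "\<not> adjacent u v" using adjacent_in_P by blast
    ultimately show ?thesis by (auto simp: L1_def R1_eq_rel_mat rel_mat_mult_entry Fminus_entry diag_P_entry)
  qed
qed

lemma L2_R2: "L2 ** R2 = Fplus + diag_P (\<lambda>u. qnum (h + k - dim u) - qnum (k - dim (u \<inter> y)))"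
proof (unfold vec_eq_iff, intro allI)
  fix u v
  show "(L2 ** R2) $ u $ v
    = (Fplus + diag_P (\<lambda>u. qnum (h + k - dim u) - qnum (k - dim (u \<inter> y)))) $ u $ v"
  proof (cases "u \<in> P \<and> v \<in> P")
    case P: True
    show ?thesis
    proof (cases "u = v")
      case True
      have "real (card {w \<in> P. backslash_covers w u}) = qnum (h + k - dim u) - qnum (k - dim (u \<inter> y))"
        using card_up[of u] card_slash_up[of u] card_split_cover_kinds(1)[of u] P by simp
      then have "complex_of_real (real (card {w \<in> P. backslash_covers w u}))
          = of_real (qnum (h + k - dim u) - qnum (k - dim (u \<inter> y)))" by (rule arg_cong)
      then show ?thesis using True P
        by (simp add: L2_def R2_eq_rel_mat rel_mat_mult_entry Fplus_entry diag_P_entry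
            not_adjacent_refl)
    next
      case False
      have "{w \<in> P. backslash_covers w u \<and> backslash_covers w v} = {w \<in> P. covers w u \<and> covers w v \<and>
          (dim (w \<inter> y) = dim (u \<inter> y) \<and> dim (w \<inter> y) = dim (v \<inter> y))}"
        by (auto simp: backslash_covers_def)
      then have card: "card {w \<in> P. backslash_covers w u \<and> backslash_covers w v} = of_bool (adjacent u v \<and>
          (dim (sub_sum u v \<inter> y) = dim (u \<inter> y) \<and> dim (sub_sum u v \<inter> y) = dim (v \<inter> y)))"
        using card_common_covers[OF _ _ False] P by simp
      have "(L2 ** R2) $ u $ v = Fplus $ u $ v"
        using P by (simp add: L2_def R2_eq_rel_mat rel_mat_mult_entry Fplus_entry card)
      then show ?thesis using False by (simp add: diag_P_entry)
    qed
  next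
    case False
    moreover from this have "\<not> adjacent u v" using adjacent_in_P by blast
    ultimately show ?thesis by (auto simp: L2_def R2_eq_rel_mat rel_mat_mult_entry Fplus_entry diag_P_entry)
  qed
qed

lemma R2_L2: "R2 ** L2 = F0 + Fplus + diag_P (\<lambda>u. qnum (dim u - dim (u \<inter> y)))"
proof (unfold vec_eq_iff, intro allI)
  fix u v
  show "(R2 ** L2) $ u $ v = (F0 + Fplus + diag_P (\<lambda>u. qnum (dim u - dim (u \<inter> y)))) $ u $ v"
  proof (cases "u \<in> P \<and> v \<in> P")
    case P: True
    show ?thesis
    proof (cases "u = v")
      case True
      have "complex_of_real (real (card {w \<in> P. backslash_covers u w}))
          = of_real (qnum (dim u - dim (u \<inter> y)))"
        using card_backslash_down P by simp
      then show ?thesis using True P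
        by (simp add: L2_def R2_eq_rel_mat rel_mat_mult_entry F0_entry Fplus_entry diag_P_entry
            not_adjacent_refl)
    next
      case False
      have "{w \<in> P. backslash_covers u w \<and> backslash_covers v w} = {w \<in> P. covers u w \<and> covers v w \<and>
          (dim (u \<inter> y) = dim (w \<inter> y) \<and> dim (v \<inter> y) = dim (w \<inter> y))}"
        by (auto simp: backslash_covers_def)
      then have card: "card {w \<in> P. backslash_covers u w \<and> backslash_covers v w} = of_bool (adjacent u v \<and>
          (dim (u \<inter> y) = dim (u \<inter> v \<inter> y) \<and> dim (v \<inter> y) = dim (u \<inter> v \<inter> y)))"
        using card_common_covered[OF _ _ False] P by simp
      have "(R2 ** L2) $ u $ v = F0 $ u $ v + Fplus $ u $ v"
      proof (cases "adjacent u v")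
        case True
        then show ?thesis using P
          by (cases rule: adjacent_cases)
            (simp_all add: L2_def R2_eq_rel_mat rel_mat_mult_entry F0_entry Fplus_entry card)
      qed (simp add: L2_def R2_eq_rel_mat rel_mat_mult_entry F0_entry Fplus_entry card)
      then show ?thesis using False by (simp add: diag_P_entry)
    qed
  next
    case False
    moreover from this have "\<not> adjacent u v" using adjacent_in_P by blast
    ultimately show ?thesis by (auto simp: L2_def R2_eq_rel_mat rel_mat_mult_entry F0_entry Fplus_entry diag_P_entry)
  qed
qed

end

context fixed_subspace
begin

text \<open>Both entries at \<open>(u, v)\<close> detect the same asymmetric pattern of adjacency, in which the step from
  \<open>u \<inter> v\<close> to \<open>v\<close> enlarges the intersection with \<open>y\<close>, as does the parallel step from \<open>u\<close> to
  \<open>u + v\<close>, while the other two steps do not.\<close>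

lemma L1_R2: "L1 ** R2 = R2 ** L1"
proof (unfold vec_eq_iff, intro allI)
  fix u v
  show "(L1 ** R2) $ u $ v = (R2 ** L1) $ u $ v"
  proof (cases "u \<in> P \<and> v \<in> P")
    case P: True
    have up: "{w \<in> P. slash_covers w u \<and> backslash_covers w v} = {w \<in> P. covers w u \<and> covers w v \<and>
        (dim (w \<inter> y) = dim (u \<inter> y) + 1 \<and> dim (w \<inter> y) = dim (v \<inter> y))}"
      by (auto simp: slash_covers_def backslash_covers_def)
    have down: "{w \<in> P. backslash_covers u w \<and> slash_covers v w} = {w \<in> P. covers u w \<and> covers v w \<and>
        (dim (u \<inter> y) = dim (w \<inter> y) \<and> dim (v \<inter> y) = dim (w \<inter> y) + 1)}"
      by (auto simp: slash_covers_def backslash_covers_def)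
    show ?thesis
    proof (cases "u = v")
      case True
      have "{w \<in> P. slash_covers w u \<and> backslash_covers w v} = {}"
        "{w \<in> P. backslash_covers u w \<and> slash_covers v w} = {}"
        using True by (auto simp: slash_covers_def backslash_covers_def)
      then show ?thesis by (simp only: L1_def R2_eq_rel_mat rel_mat_mult_entry card.empty)
    next
      case False
      have card: "card {w \<in> P. slash_covers w u \<and> backslash_covers w v} = of_bool (adjacent u v \<and>
          (dim (sub_sum u v \<inter> y) = dim (u \<inter> y) + 1 \<and> dim (sub_sum u v \<inter> y) = dim (v \<inter> y)))"
        "card {w \<in> P. backslash_covers u w \<and> slash_covers v w} = of_bool (adjacent u v \<and>
          (dim (u \<inter> y) = dim (u \<inter> v \<inter> y) \<and> dim (v \<inter> y) = dim (u \<inter> v \<inter> y) + 1))"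
        using card_common_covers[OF _ _ False] card_common_covered[OF _ _ False] P up down by simp_all
      show ?thesis
      proof (cases "adjacent u v")
        case True
        then show ?thesis using P
          by (cases rule: adjacent_cases) (simp_all add: L1_def R2_eq_rel_mat rel_mat_mult_entry card)
      qed (simp add: L1_def R2_eq_rel_mat rel_mat_mult_entry card)
    qed
  qed (auto simp: L1_def R2_eq_rel_mat rel_mat_mult_entry)
qed

text \<open>In an interval of length two on which the intersection with the fixed subspace grows by one,
  exactly one of the \<open>q + 1\<close> intermediate subspaces, namely \<open>u + (v \<inter> y)\<close>, is reached by the step
  that enlarges the intersection.\<close>

lemma L2_L1: "L2 ** L1 = q *\<^sub>R (L1 ** L2)"
proof (unfold vec_eq_iff, intro allI)
  fix u v
  show "(L2 ** L1) $ u $ v = (q *\<^sub>R (L1 ** L2)) $ u $ v"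
  proof (cases "u \<in> P \<and> v \<in> P")
    case P: True
    let ?A = "{w \<in> P. slash_covers w u \<and> backslash_covers v w}"
    let ?B = "{w \<in> P. backslash_covers w u \<and> slash_covers v w}"
    have s: "subspace u" "subspace v" using P by (auto simp: P_iff)
    have "real (card ?B) = q * real (card ?A)"
    proof (cases "u \<subseteq> v \<and> dim v = dim u + 2 \<and> dim (v \<inter> y) = dim (u \<inter> y) + 1")
      case False
      have "?A = {}" "?B = {}"
        using False unfolding slash_covers_def backslash_covers_def covers_def by fastforce+
      then show ?thesis by (metis card.empty mult_zero_right of_nat_0)
    next
      case True
      let ?m = "sub_sum u (v \<inter> y)"
      have m: "subspace ?m" "u \<subseteq> ?m" "?m \<subseteq> v" "v \<inter> y \<subseteq> ?m"
        using subspace_sub_sum[OF s(1) subspace_Int_y[OF s(2)]]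
          sub_sum_upper1[OF subspace_Int_y[OF s(2)], of u] sub_sum_upper2[OF s(1), of "v \<inter> y"]
          sub_sum_least[OF s(2), of u "v \<inter> y"] True by auto
      have "dim ?m + dim (u \<inter> (v \<inter> y)) = dim u + dim (v \<inter> y)"
        by (rule dim_sub_sum_Int[OF s(1) subspace_Int_y[OF s(2)]])
      moreover have "u \<inter> (v \<inter> y) = u \<inter> y" using True by blast
      ultimately have dm: "dim ?m = dim u + 1" using True by simp
      have my: "?m \<inter> y = v \<inter> y" using m by blast
      have C: "covers_within u v = {w \<in> P. covers w u \<and> covers v w}"
        using s True by (auto simp: covers_within_def covers_def P_iff)
      have "?A = {?m}"
      proof (intro equalityI subsetI)
        fix w assume w: "w \<in> ?A"
        then have "v \<inter> y \<subseteq> w" using backslash_covers_iff_Int_subset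
          by (auto simp: backslash_covers_def)
        moreover have w': "subspace w" "u \<subseteq> w" "dim w = dim u + 1"
          using w by (auto simp: slash_covers_def covers_def P_iff)
        ultimately have "?m \<subseteq> w" by (intro sub_sum_least)
        then show "w \<in> {?m}" using subspace_eq_if_dim_eq[OF m(1) w'(1)] dm w'(3) by simp
      next
        fix w assume "w \<in> {?m}"
        then have w: "w = ?m" by simp
        have "covers ?m u" "covers v ?m"
          using m(1-3) s dm True by (simp_all add: covers_def P_iff)
        then show "w \<in> ?A" using m(1) my True
          by (simp add: w slash_covers_def backslash_covers_def P_iff)
      qed
      then have cA: "card ?A = 1" by (metis card_1_singleton_iff One_nat_def)
      have "covers_within u v = ?A \<union> ?B"
      proof (intro equalityI subsetI)
        fix w assume "w \<in> covers_within u v"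
        then have "w \<in> P" "covers w u" "covers v w" using C by auto
        note w = this
        show "w \<in> ?A \<union> ?B"
        proof (cases "dim (w \<inter> y) = dim (u \<inter> y)")
          case eq: True
          then have "dim (v \<inter> y) = dim (w \<inter> y) + 1" using True by simp
          then have "w \<in> ?B" using w eq by (simp add: slash_covers_def backslash_covers_def)
          then show ?thesis by blast
        next
          case False
          then have d: "dim (w \<inter> y) = dim (u \<inter> y) + 1" using covers_dim_Int_y[OF w(2)] by blast
          then have "dim (v \<inter> y) = dim (w \<inter> y)" using True by simp
          then have "w \<in> ?A" using w d by (simp add: slash_covers_def backslash_covers_def)
          then show ?thesis by blast
        qed
      qed (auto simp: C slash_covers_def backslash_covers_def)
      moreover have "?A \<inter> ?B = {}" by (auto simp: slash_covers_def backslash_covers_def)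
      ultimately have "card (covers_within u v) = card ?A + card ?B"
        by (simp only: card_Un_disjoint[OF finite finite])
      moreover have "dim v - dim u = 2" using True by presburger
      then have "card (covers_within u v) = 1 + CARD('f)"
        using card_covers_within[OF s] True by (simp only: numeral_2_eq_2) simp
      ultimately have B: "card ?B = CARD('f)" using cA by linarith
      show ?thesis unfolding cA B q_eq by simp
    qed
    then have "complex_of_real (real (card ?B)) = of_real (q * real (card ?A))" by (rule arg_cong)
    then have "(L2 ** L1) $ u $ v = complex_of_real q * (L1 ** L2) $ u $ v"
      using P by (simp add: L1_def L2_def rel_mat_mult_entry)
    then show ?thesis by (simp add: scaleR_conv_of_real[where 'a = complex])
  qed (auto simp: L1_def L2_def rel_mat_mult_entry)
qed

lemma transpose_scaleR: "transpose (c *\<^sub>R A) = c *\<^sub>R transpose A"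
  by (simp add: transpose_def vec_eq_iff)

lemma R1_R2: "R1 ** R2 = q *\<^sub>R (R2 ** R1)"
  using arg_cong[OF L2_L1, of transpose] by (simp add: matrix_transpose_mul R1_def R2_def transpose_scaleR)

lemma L2_R1: "L2 ** R1 = R1 ** L2"
  using arg_cong[OF L1_R2, of transpose] by (simp add: matrix_transpose_mul R1_def R2_def)

end

section \<open>Vectors supported on one block\<close>

lemma scaleR_matrix_mult_vec: "(c *\<^sub>R A) *v x = c *\<^sub>R (A *v (x :: complex^'n))"
  by (simp add: vec_eq_iff matrix_vector_mult_def scaleR_sum_right)

lemma matrix_mult_vec_scaleR: "A *v (c *\<^sub>R x) = c *\<^sub>R (A *v (x :: complex^'n))"
  by (simp add: vec_eq_iff matrix_vector_mult_def scaleR_sum_right)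

lemma mult_vec_sum: "A *v (\<Sum>i\<in>S. f i) = (\<Sum>i\<in>S. A *v (f i :: complex^'n))"
  by (induction S rule: infinite_finite_induct) (simp_all add: matrix_vector_right_distrib)

lemma of_real_scale_eq_scaleR: "complex_of_real c *s x = c *\<^sub>R x"
  by (simp add: vec_eq_iff scaleR_conv_of_real[where 'a = complex])

context fixed_subspace
begin

definition homog :: "nat \<Rightarrow> nat \<Rightarrow> (complex^'v set) set" where
  "homog i j = {x. \<forall>u. u \<notin> P_part i j \<longrightarrow> x $ u = 0}"

lemma P_part_bounds:
  assumes "u \<in> P_part i j"
  shows "i \<le> k" "j \<le> h"
proof -
  have u: "subspace u" "dim (u \<inter> y) = i" "dim u = i + j" using assms by (auto simp: P_part_def P_iff)
  have "dim (u \<inter> y) \<le> dim y" by (rule fd.dim_subset) blast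
  then show "i \<le> k" using u dim_y by simp
  have "dim (sub_sum u y) \<le> h + k"
    using fd.dim_subset[OF subset_UNIV] dim_UNIV by metis
  then show "j \<le> h" using dim_sub_sum_Int[OF u(1) subspace_y] u dim_y by linarith
qed

lemma homog_eq_0: "k < i \<or> h < j \<Longrightarrow> x \<in> homog i j \<Longrightarrow> x = 0"
  using P_part_bounds by (fastforce simp: homog_def vec_eq_iff)

lemma homog_subspace: "vec.subspace (homog i j)"
  by (auto simp: homog_def vec.subspace_def)

lemma diag_P_mult_vec: "(diag_P d *v x) $ u = (if u \<in> P then complex_of_real (d u) * x $ u else 0)"
proof -
  have "(diag_P d *v x) $ u = (\<Sum>v\<in>UNIV. diag_P d $ u $ v * x $ v)"
    by (simp add: matrix_vector_mult_def)
  also have "\<dots> = (\<Sum>v\<in>UNIV. if v = u then (if u \<in> P then complex_of_real (d u) * x $ u else 0) else 0)"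
    by (rule sum.cong) (auto simp: diag_P_entry)
  finally show ?thesis by simp
qed

lemma diag_P_homog:
  assumes "x \<in> homog i j" and "\<And>u. u \<in> P_part i j \<Longrightarrow> d u = c"
  shows "diag_P d *v x = c *\<^sub>R x"
proof (unfold vec_eq_iff, intro allI)
  fix u
  show "(diag_P d *v x) $ u = (c *\<^sub>R x) $ u"
    using assms by (cases "u \<in> P_part i j")
      (auto simp: diag_P_mult_vec homog_def P_part_def scaleR_conv_of_real[where 'a = complex])
qed

lemma Estar_mult_vec: "(Estar i j *v x) $ u = (if u \<in> P_part i j then x $ u else 0)"
  by (simp add: Estar_def diag_P_mult_vec P_part_def)

lemma Estar_mult_vec_homog: "Estar i j *v x \<in> homog i j"
  by (simp add: homog_def Estar_mult_vec)

lemma Estar_fixes_homog: "x \<in> homog i j \<Longrightarrow> Estar i j *v x = x"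
  by (auto simp: homog_def vec_eq_iff Estar_mult_vec)

lemma V_decompose:
  assumes "x \<in> V"
  shows "x = (\<Sum>i\<le>k. \<Sum>j\<le>h. Estar i j *v x)"
proof (unfold vec_eq_iff, intro allI)
  fix u
  show "x $ u = (\<Sum>i\<le>k. \<Sum>j\<le>h. Estar i j *v x) $ u"
  proof (cases "u \<in> P")
    case False
    then show ?thesis using assms by (simp add: V_def Estar_mult_vec P_part_def)
  next
    case True
    define a b where "a = dim (u \<inter> y)" and "b = dim u - dim (u \<inter> y)"
    have "dim (u \<inter> y) \<le> dim u" by (rule fd.dim_subset) blast
    then have ab: "u \<in> P_part i j \<longleftrightarrow> i = a \<and> j = b" for i j
      using True unfolding a_def b_def P_part_def by auto
    have "a \<le> k" "b \<le> h" using P_part_bounds[of u a b] ab by auto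
    have "(\<Sum>i\<le>k. \<Sum>j\<le>h. Estar i j *v x) $ u = (\<Sum>i\<le>k. \<Sum>j\<le>h. if i = a \<and> j = b then x $ u else 0)"
      by (simp add: Estar_mult_vec ab)
    also have "\<dots> = (\<Sum>i\<le>k. if i = a then x $ u else 0)"
      using \<open>b \<le> h\<close> by (intro sum.cong) auto
    also have "\<dots> = x $ u" using \<open>a \<le> k\<close> by simp
    finally show ?thesis by simp
  qed
qed

text \<open>Identities between operators on \<open>V\<close> may be checked block by block, where all diagonal
  matrices in question become scalars.\<close>

lemma mult_vec_eqI_V:
  fixes A B :: "complex^'v set^'v set"
  assumes "\<And>i j x. x \<in> homog i j \<Longrightarrow> A *v x = B *v x" and "x \<in> V"
  shows "A *v x = B *v x"
proof -
  have dec: "M *v x = (\<Sum>i\<le>k. \<Sum>j\<le>h. M *v (Estar i j *v x))" for M :: "complex^'v set^'v set"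
  proof -
    have "M *v x = M *v (\<Sum>i\<le>k. \<Sum>j\<le>h. Estar i j *v x)" using V_decompose[OF assms(2)] by simp
    also have "\<dots> = (\<Sum>i\<le>k. \<Sum>j\<le>h. M *v (Estar i j *v x))"
      by (simp add: mult_vec_sum)
    finally show ?thesis .
  qed
  have "A *v (Estar i j *v x) = B *v (Estar i j *v x)" for i j
    by (rule assms(1)[OF Estar_mult_vec_homog])
  then show ?thesis unfolding dec[of A] dec[of B] by simp
qed

lemma rel_mat_homog:
  assumes "x \<in> homog i j"
    and "\<And>u v. u \<in> P \<Longrightarrow> v \<in> P_part i j \<Longrightarrow> r u v \<Longrightarrow> u \<in> P_part i' j'"
  shows "rel_mat r *v x \<in> homog i' j'"
proof (unfold homog_def, intro CollectI allI impI)
  fix u assume u: "u \<notin> P_part i' j'"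
  have "rel_mat r $ u $ v * x $ v = 0" for v
    using assms u by (cases "v \<in> P_part i j") (auto simp: homog_def rel_mat_entry)
  then have "(\<Sum>v\<in>UNIV. rel_mat r $ u $ v * x $ v) = 0" by (intro sum.neutral) blast
  then show "(rel_mat r *v x) $ u = 0" by (simp add: matrix_vector_mult_def)
qed

lemma L1_homog: "x \<in> homog (Suc i) j \<Longrightarrow> L1 *v x \<in> homog i j"
  unfolding L1_def by (rule rel_mat_homog) (auto simp: slash_covers_def covers_def P_part_def)

lemma R1_homog: "x \<in> homog i j \<Longrightarrow> R1 *v x \<in> homog (Suc i) j"
  unfolding R1_eq_rel_mat by (rule rel_mat_homog) (auto simp: slash_covers_def covers_def P_part_def)

lemma L2_homog: "x \<in> homog i (Suc j) \<Longrightarrow> L2 *v x \<in> homog i j"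
  unfolding L2_def by (rule rel_mat_homog) (auto simp: backslash_covers_def covers_def P_part_def)

lemma R2_homog: "x \<in> homog i j \<Longrightarrow> R2 *v x \<in> homog i (Suc j)"
  unfolding R2_eq_rel_mat by (rule rel_mat_homog) (auto simp: backslash_covers_def covers_def P_part_def)

text \<open>Lowering below the bottom gives zero.  A block with first index \<open>Suc k\<close> is empty, so
  membership in it is a way to say that a vector vanishes.\<close>

lemma L1_homog_0:
  assumes "x \<in> homog 0 j"
  shows "L1 *v x = 0"
proof -
  have "L1 *v x \<in> homog (Suc k) j" unfolding L1_def
    by (rule rel_mat_homog[OF assms]) (simp add: slash_covers_def P_part_def del: fd.dim_eq_0)
  then show ?thesis using homog_eq_0 by blast
qed

lemma L2_homog_0:
  assumes "x \<in> homog i 0"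
  shows "L2 *v x = 0"
proof -
  have "L2 *v x \<in> homog (Suc k) 0" unfolding L2_def
  proof (rule rel_mat_homog[OF assms])
    fix u v assume uv: "u \<in> P" "v \<in> P_part i 0" "backslash_covers v u"
    have "dim (u \<inter> y) \<le> dim u" by (rule fd.dim_subset) blast
    then have False using uv by (simp add: backslash_covers_def covers_def P_part_def)
    then show "u \<in> P_part (Suc k) 0" ..
  qed
  then show ?thesis using homog_eq_0 by blast
qed

lemma F0_homog: "x \<in> homog i j \<Longrightarrow> F0 *v x \<in> homog i j"
  unfolding F0_def
  by (rule rel_mat_homog) (auto simp: slash_covers_def backslash_covers_def covers_def P_part_def)

end

section \<open>The element \<open>Omega0\<close> is central\<close>

context fixed_subspace
begin

lemma sqrt_powers:
  "q powr (real h / 2) * q powr (real h / 2) = q ^ h"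
  "q powr (real k / 2) * q powr (real k / 2) = q ^ k"
  using q_ge_2 by (simp_all add: powr_add[symmetric] powr_realpow)

lemma powr_half_h_k: "q powr ((real h + real k) / 2) = q powr (real h / 2) * q powr (real k / 2)"
  by (simp add: powr_add[symmetric] add_divide_distrib)

lemma K_homog:
  assumes "x \<in> homog i j"
  shows "K1 *v x = (q powr (real k / 2) / q ^ i) *\<^sub>R x"
    and "K1inv *v x = (q ^ i / q powr (real k / 2)) *\<^sub>R x"
    and "K2 *v x = (q ^ j / q powr (real h / 2)) *\<^sub>R x"
    and "K2inv *v x = (q powr (real h / 2) / q ^ j) *\<^sub>R x"
    and "Id_P *v x = x"
proof -
  have w: "wt1 u = q powr (real k / 2) / q ^ i" "wt2 u = q ^ j / q powr (real h / 2)"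
    if "u \<in> P_part i j" for u
    using that q_ge_2 by (simp_all add: wt1_def wt2_def P_part_def powr_diff powr_realpow)
  show "K1 *v x = (q powr (real k / 2) / q ^ i) *\<^sub>R x"
    "K2 *v x = (q ^ j / q powr (real h / 2)) *\<^sub>R x"
    unfolding K1_def K2_def by (rule diag_P_homog[OF assms]; simp add: w)+
  show "K1inv *v x = (q ^ i / q powr (real k / 2)) *\<^sub>R x"
    "K2inv *v x = (q powr (real h / 2) / q ^ j) *\<^sub>R x"
    unfolding K1inv_def K2inv_def by (rule diag_P_homog[OF assms]; simp add: w)+
  show "Id_P *v x = x" unfolding Id_P_def using diag_P_homog[OF assms, of _ 1] by simp
qed

text \<open>On the block with indices \<open>i\<close> and \<open>j\<close>, the matrix \<open>F0\<close> is \<open>L1 R1 - R1 L1\<close> plus the scalar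
  \<open>defect1 i j\<close>, and it is \<open>R2 L2 - L2 R2\<close> plus the scalar \<open>defect2 i j\<close>.\<close>

definition defect1 :: "nat \<Rightarrow> nat \<Rightarrow> real" where
  "defect1 i j = qnum (i + j) - qnum j - qnum (k - i)"

definition defect2 :: "nat \<Rightarrow> nat \<Rightarrow> real" where
  "defect2 i j = qnum (h + k - (i + j)) - qnum (k - i) - qnum j"

lemma Fminus_homog:
  assumes "x \<in> homog i j"
  shows "Fminus *v x = R1 *v (L1 *v x) - (qnum (i + j) - qnum j) *\<^sub>R x"
proof -
  have "R1 *v (L1 *v x) = Fminus *v x + diag_P (\<lambda>u. qnum (dim u) - qnum (dim u - dim (u \<inter> y))) *v x"
    by (simp add: matrix_vector_mul_assoc R1_L1 matrix_vector_mult_add_rdistrib)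
  also have "diag_P (\<lambda>u. qnum (dim u) - qnum (dim u - dim (u \<inter> y))) *v x = (qnum (i + j) - qnum j) *\<^sub>R x"
    by (rule diag_P_homog[OF assms]) (simp add: P_part_def)
  finally show ?thesis by simp
qed

lemma Fplus_homog:
  assumes "x \<in> homog i j"
  shows "Fplus *v x = L2 *v (R2 *v x) - (qnum (h + k - (i + j)) - qnum (k - i)) *\<^sub>R x"
proof -
  have "L2 *v (R2 *v x) = Fplus *v x + diag_P (\<lambda>u. qnum (h + k - dim u) - qnum (k - dim (u \<inter> y))) *v x"
    by (simp add: matrix_vector_mul_assoc L2_R2 matrix_vector_mult_add_rdistrib)
  also have "diag_P (\<lambda>u. qnum (h + k - dim u) - qnum (k - dim (u \<inter> y))) *v x
      = (qnum (h + k - (i + j)) - qnum (k - i)) *\<^sub>R x"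
    by (rule diag_P_homog[OF assms]) (simp add: P_part_def)
  finally show ?thesis by simp
qed

lemma F0_homog_commutator1:
  assumes "x \<in> homog i j"
  shows "F0 *v x = L1 *v (R1 *v x) - R1 *v (L1 *v x) + defect1 i j *\<^sub>R x"
proof -
  have "L1 *v (R1 *v x) = F0 *v x + Fminus *v x + diag_P (\<lambda>u. qnum (k - dim (u \<inter> y))) *v x"
    by (simp add: matrix_vector_mul_assoc L1_R1 matrix_vector_mult_add_rdistrib)
  also have "diag_P (\<lambda>u. qnum (k - dim (u \<inter> y))) *v x = qnum (k - i) *\<^sub>R x"
    by (rule diag_P_homog[OF assms]) (simp add: P_part_def)
  finally show ?thesis by (simp add: Fminus_homog[OF assms] defect1_def scaleR_diff_left)
qed

lemma F0_homog_commutator2: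
  assumes "x \<in> homog i j"
  shows "F0 *v x = R2 *v (L2 *v x) - L2 *v (R2 *v x) + defect2 i j *\<^sub>R x"
proof -
  have "R2 *v (L2 *v x) = F0 *v x + Fplus *v x + diag_P (\<lambda>u. qnum (dim u - dim (u \<inter> y))) *v x"
    by (simp add: matrix_vector_mul_assoc R2_L2 matrix_vector_mult_add_rdistrib)
  also have "diag_P (\<lambda>u. qnum (dim u - dim (u \<inter> y))) *v x = qnum j *\<^sub>R x"
    by (rule diag_P_homog[OF assms]) (simp add: P_part_def)
  finally show ?thesis by (simp add: Fplus_homog[OF assms] defect2_def scaleR_diff_left)
qed

lemma exchange:
  "L2 *v (L1 *v x) = q *\<^sub>R (L1 *v (L2 *v x))" "R1 *v (R2 *v x) = q *\<^sub>R (R2 *v (R1 *v x))"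
  "L1 *v (R2 *v x) = R2 *v (L1 *v x)" "L2 *v (R1 *v x) = R1 *v (L2 *v x)"
  by (simp_all add: matrix_vector_mul_assoc L2_L1 R1_R2 L1_R2 L2_R1 flip: scaleR_matrix_mult_vec)

text \<open>The lowering and raising matrices of one direction commute with those of the other up to
  powers of \<open>q\<close>.  Moving \<open>L1\<close> or \<open>R1\<close> through the commutator of \<open>R2\<close> and \<open>L2\<close> therefore costs a
  power of \<open>q\<close>, and so does moving \<open>L2\<close> or \<open>R2\<close> through the commutator of \<open>L1\<close> and \<open>R1\<close>.  Hence
  \<open>F0\<close> commutes with each of them up to a power of \<open>q\<close> and an additive multiple.\<close>

lemma F0_L1:
  assumes x: "x \<in> homog (Suc i) j"
  shows "F0 *v (L1 *v x) = q *\<^sub>R (L1 *v (F0 *v x)) + (defect2 i j - q * defect2 (Suc i) j) *\<^sub>R (L1 *v x)"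
proof -
  have "F0 *v (L1 *v x) = R2 *v (L2 *v (L1 *v x)) - L2 *v (R2 *v (L1 *v x)) + defect2 i j *\<^sub>R (L1 *v x)"
    by (rule F0_homog_commutator2[OF L1_homog[OF x]])
  also have "R2 *v (L2 *v (L1 *v x)) = q *\<^sub>R (L1 *v (R2 *v (L2 *v x)))"
    by (simp add: exchange(1,3) matrix_mult_vec_scaleR)
  also have "L2 *v (R2 *v (L1 *v x)) = q *\<^sub>R (L1 *v (L2 *v (R2 *v x)))"
    by (simp only: exchange(1) exchange(3)[symmetric])
  also have "q *\<^sub>R (L1 *v (R2 *v (L2 *v x))) - q *\<^sub>R (L1 *v (L2 *v (R2 *v x)))
      = q *\<^sub>R (L1 *v (F0 *v x - defect2 (Suc i) j *\<^sub>R x))"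
    unfolding F0_homog_commutator2[OF x]
    by (simp add: matrix_vector_mult_diff_distrib scaleR_diff_right)
  finally show ?thesis
    by (simp add: matrix_vector_mult_diff_distrib matrix_mult_vec_scaleR scaleR_diff_left scaleR_diff_right)
qed

lemma F0_R1:
  assumes x: "x \<in> homog i j"
  shows "q *\<^sub>R (F0 *v (R1 *v x)) = R1 *v (F0 *v x) + (q * defect2 (Suc i) j - defect2 i j) *\<^sub>R (R1 *v x)"
proof -
  have "q *\<^sub>R (F0 *v (R1 *v x)) = q *\<^sub>R (R2 *v (L2 *v (R1 *v x))) - q *\<^sub>R (L2 *v (R2 *v (R1 *v x)))
      + (q * defect2 (Suc i) j) *\<^sub>R (R1 *v x)"
    unfolding F0_homog_commutator2[OF R1_homog[OF x]]
    by (simp add: scaleR_diff_right scaleR_add_right)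
  also have "q *\<^sub>R (R2 *v (L2 *v (R1 *v x))) = R1 *v (R2 *v (L2 *v x))"
    by (simp add: exchange(2,4))
  also have "q *\<^sub>R (L2 *v (R2 *v (R1 *v x))) = R1 *v (L2 *v (R2 *v x))"
    by (simp only: matrix_mult_vec_scaleR[of L2, symmetric] exchange(2)[symmetric] exchange(4))
  also have "R1 *v (R2 *v (L2 *v x)) - R1 *v (L2 *v (R2 *v x)) = R1 *v (F0 *v x - defect2 i j *\<^sub>R x)"
    unfolding F0_homog_commutator2[OF x] by (simp add: matrix_vector_mult_diff_distrib)
  finally show ?thesis
    by (simp add: matrix_vector_mult_diff_distrib matrix_mult_vec_scaleR scaleR_diff_left)
qed

lemma F0_L2:
  assumes x: "x \<in> homog i (Suc j)"
  shows "q *\<^sub>R (F0 *v (L2 *v x)) = L2 *v (F0 *v x) + (q * defect1 i j - defect1 i (Suc j)) *\<^sub>R (L2 *v x)"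
proof -
  have "q *\<^sub>R (F0 *v (L2 *v x)) = q *\<^sub>R (L1 *v (R1 *v (L2 *v x))) - q *\<^sub>R (R1 *v (L1 *v (L2 *v x)))
      + (q * defect1 i j) *\<^sub>R (L2 *v x)"
    unfolding F0_homog_commutator1[OF L2_homog[OF x]]
    by (simp add: scaleR_diff_right scaleR_add_right)
  also have "q *\<^sub>R (L1 *v (R1 *v (L2 *v x))) = L2 *v (L1 *v (R1 *v x))"
    by (simp only: exchange(1) exchange(4)[symmetric])
  also have "q *\<^sub>R (R1 *v (L1 *v (L2 *v x))) = L2 *v (R1 *v (L1 *v x))"
    by (simp add: exchange(1,4) matrix_mult_vec_scaleR)
  also have "L2 *v (L1 *v (R1 *v x)) - L2 *v (R1 *v (L1 *v x)) = L2 *v (F0 *v x - defect1 i (Suc j) *\<^sub>R x)"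
    unfolding F0_homog_commutator1[OF x] by (simp add: matrix_vector_mult_diff_distrib)
  finally show ?thesis
    by (simp add: matrix_vector_mult_diff_distrib matrix_mult_vec_scaleR scaleR_diff_left)
qed

lemma F0_R2:
  assumes x: "x \<in> homog i j"
  shows "F0 *v (R2 *v x) = q *\<^sub>R (R2 *v (F0 *v x)) + (defect1 i (Suc j) - q * defect1 i j) *\<^sub>R (R2 *v x)"
proof -
  have "F0 *v (R2 *v x) = L1 *v (R1 *v (R2 *v x)) - R1 *v (L1 *v (R2 *v x)) + defect1 i (Suc j) *\<^sub>R (R2 *v x)"
    by (rule F0_homog_commutator1[OF R2_homog[OF x]])
  also have "L1 *v (R1 *v (R2 *v x)) = q *\<^sub>R (R2 *v (L1 *v (R1 *v x)))"
    by (simp add: exchange(2,3) matrix_mult_vec_scaleR)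
  also have "R1 *v (L1 *v (R2 *v x)) = q *\<^sub>R (R2 *v (R1 *v (L1 *v x)))"
    by (simp add: exchange(2,3))
  also have "q *\<^sub>R (R2 *v (L1 *v (R1 *v x))) - q *\<^sub>R (R2 *v (R1 *v (L1 *v x)))
      = q *\<^sub>R (R2 *v (F0 *v x - defect1 i j *\<^sub>R x))"
    unfolding F0_homog_commutator1[OF x]
    by (simp add: matrix_vector_mult_diff_distrib scaleR_diff_right)
  finally show ?thesis
    by (simp add: matrix_vector_mult_diff_distrib matrix_mult_vec_scaleR scaleR_diff_left scaleR_diff_right)
qed

text \<open>On the block with indices \<open>i\<close> and \<open>j\<close>, the element \<open>Omega0\<close> is
  \<open>(q - 1) * weight0 i j\<close> times \<open>F0\<close> plus the scalar \<open>shift0 i j\<close>.\<close>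

definition weight0 :: "nat \<Rightarrow> nat \<Rightarrow> real" where
  "weight0 i j = q ^ i / (q ^ j * q ^ k)"

definition shift0 :: "nat \<Rightarrow> nat \<Rightarrow> real" where
  "shift0 i j = q ^ i / q ^ k + 1 / q ^ j - weight0 i j"

lemma Omega0_homog:
  assumes x: "x \<in> homog i j"
  shows "Omega0 *v x = ((q - 1) * weight0 i j) *\<^sub>R (F0 *v x) + shift0 i j *\<^sub>R x"
proof -
  let ?H = "q powr (real h / 2)" and ?K = "q powr (real k / 2)"
  let ?a = "q ^ i / ?K" and ?b = "?H / q ^ j"
  have pos: "?H > 0" "?K > 0" "q > 0" using q_ge_2 by auto
  have c: "q powr (- (real h + real k) / 2) = 1 / (?H * ?K)"
    unfolding minus_divide_left[symmetric] powr_minus_divide powr_half_h_k ..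
  have "Omega0 *v x = (1 / (?H * ?K)) *\<^sub>R ((q - 1) *\<^sub>R (?a * ?b) *\<^sub>R (F0 *v x)
      + ?H *\<^sub>R ?a *\<^sub>R x + ?K *\<^sub>R ?b *\<^sub>R x - (?a * ?b) *\<^sub>R x)"
    unfolding Omega0_def c
    by (simp add: matrix_vector_mult_add_rdistrib matrix_vector_mult_diff_rdistrib
        scaleR_matrix_mult_vec matrix_vector_mul_assoc[symmetric] K_homog[OF x] matrix_mult_vec_scaleR
        mult.commute)
  also have "\<dots> = (1 / (?H * ?K) * ((q - 1) * (?a * ?b))) *\<^sub>R (F0 *v x)
      + (1 / (?H * ?K) * (?H * ?a + ?K * ?b - ?a * ?b)) *\<^sub>R x"
    by (simp only: scaleR_add_right scaleR_diff_right scaleR_scaleR scaleR_add_left scaleR_diff_left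
        ring_distribs) simp
  also have "1 / (?H * ?K) * ((q - 1) * (?a * ?b)) = (q - 1) * weight0 i j"
    using pos by (simp add: weight0_def sqrt_powers(2)[symmetric] field_simps)
  also have "1 / (?H * ?K) * (?H * ?a + ?K * ?b - ?a * ?b) = shift0 i j"
    using pos by (simp add: shift0_def weight0_def sqrt_powers(2)[symmetric] field_simps)
  finally show ?thesis .
qed

lemma Omega0_preserves_homog: "x \<in> homog i j \<Longrightarrow> Omega0 *v x \<in> homog i j"
  using F0_homog[of x i j] by (auto simp: Omega0_homog homog_def)

lemma power_diff_real: "n \<le> m \<Longrightarrow> q ^ (m - n) = q ^ m / q ^ n"
  using q_ge_2 by (simp add: power_diff)

lemma q_minus_1_qnum: "(q - 1) * qnum n = q ^ n - 1"
  using q_ge_2 by (simp add: qnum_def)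

lemma q_minus_1_defect1:
  assumes "i \<le> k"
  shows "(q - 1) * defect1 i j = q ^ i * q ^ j - q ^ j - q ^ k / q ^ i + 1"
  unfolding defect1_def right_diff_distrib q_minus_1_qnum power_diff_real[OF assms] power_add by simp

lemma q_minus_1_defect2:
  assumes "i \<le> k" "j \<le> h"
  shows "(q - 1) * defect2 i j = q ^ h * q ^ k / (q ^ i * q ^ j) - q ^ k / q ^ i - q ^ j + 1"
proof -
  have "i + j \<le> h + k" using assms by simp
  then show ?thesis
    unfolding defect2_def right_diff_distrib q_minus_1_qnum power_diff_real[OF assms(1)]
    by (simp add: power_diff_real power_add)
qed

lemma weight0_Suc: "weight0 (Suc i) j = q * weight0 i j" "q * weight0 i (Suc j) = weight0 i j"
  using q_ge_2 by (simp_all add: weight0_def)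

text \<open>The next two identities are what centrality of \<open>Omega0\<close> amounts to: along a step to a
  neighbouring block the change of \<open>shift0\<close> cancels the scalar by which \<open>F0\<close> fails to commute
  with the step up to a power of \<open>q\<close>.\<close>

lemma shift0_Suc_left:
  assumes "Suc i \<le> k" "j \<le> h"
  shows "(q - 1) * weight0 i j * (defect2 i j - q * defect2 (Suc i) j) = shift0 (Suc i) j - shift0 i j"
proof -
  have nz: "q \<noteq> 0" "q - 1 \<noteq> 0" using q_ge_2 by auto
  have "(q - 1) * (defect2 i j - q * defect2 (Suc i) j)
      = (q - 1) * defect2 i j - q * ((q - 1) * defect2 (Suc i) j)" by (simp add: algebra_simps)
  also have "\<dots> = (q - 1) * (q ^ j - 1)"
    using nz assms by (simp add: q_minus_1_defect2) (simp add: field_simps)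
  finally have "(q - 1) * (defect2 i j - q * defect2 (Suc i) j) = (q - 1) * (q ^ j - 1)" .
  then have "(q - 1) * weight0 i j * (defect2 i j - q * defect2 (Suc i) j)
      = weight0 i j * ((q - 1) * (q ^ j - 1))" by (metis mult.assoc mult.commute)
  also have "\<dots> = shift0 (Suc i) j - shift0 i j"
    using nz by (simp add: shift0_def weight0_def field_simps)
  finally show ?thesis .
qed

lemma shift0_Suc_right:
  assumes "i \<le> k"
  shows "(q - 1) * weight0 i (Suc j) * (q * defect1 i j - defect1 i (Suc j)) = shift0 i (Suc j) - shift0 i j"
proof -
  have nz: "q \<noteq> 0" "q - 1 \<noteq> 0" using q_ge_2 by auto
  have "(q - 1) * (q * defect1 i j - defect1 i (Suc j))
      = q * ((q - 1) * defect1 i j) - (q - 1) * defect1 i (Suc j)" by (simp add: algebra_simps)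
  also have "\<dots> = (q - 1) * (1 - q ^ k / q ^ i)"
    using nz assms by (simp add: q_minus_1_defect1) (simp add: field_simps)
  finally have "(q - 1) * (q * defect1 i j - defect1 i (Suc j)) = (q - 1) * (1 - q ^ k / q ^ i)" .
  then have "(q - 1) * weight0 i (Suc j) * (q * defect1 i j - defect1 i (Suc j))
      = weight0 i (Suc j) * ((q - 1) * (1 - q ^ k / q ^ i))" by (metis mult.assoc mult.commute)
  also have "\<dots> = shift0 i (Suc j) - shift0 i j"
    using nz by (simp add: shift0_def weight0_def field_simps)
  finally show ?thesis .
qed

lemma Omega0_L1_homog:
  assumes x: "x \<in> homog i j"
  shows "Omega0 *v (L1 *v x) = L1 *v (Omega0 *v x)"
proof (cases "i = 0 \<or> k < i \<or> h < j")
  case True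
  then have "L1 *v x = 0" "L1 *v (Omega0 *v x) = 0"
    using L1_homog_0 homog_eq_0 Omega0_preserves_homog[OF x] x by (metis matrix_vector_mult_0_right)+
  then show ?thesis by simp
next
  case False
  then obtain a where i: "i = Suc a" and b: "Suc a \<le> k" "j \<le> h" by (cases i) auto
  have "Omega0 *v (L1 *v x) = ((q - 1) * weight0 (Suc a) j) *\<^sub>R (L1 *v (F0 *v x))
      + ((q - 1) * weight0 a j * (defect2 a j - q * defect2 (Suc a) j) + shift0 a j) *\<^sub>R (L1 *v x)"
    unfolding Omega0_homog[OF L1_homog[OF x[unfolded i]]] F0_L1[OF x[unfolded i]] weight0_Suc
    by (simp add: scaleR_add_right scaleR_add_left mult_ac)
  then show ?thesis
    unfolding shift0_Suc_left[OF b] Omega0_homog[OF x] i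
    by (simp add: matrix_vector_right_distrib matrix_mult_vec_scaleR)
qed

lemma Omega0_R1_homog:
  assumes x: "x \<in> homog i j"
  shows "Omega0 *v (R1 *v x) = R1 *v (Omega0 *v x)"
proof (cases "k < Suc i \<or> h < j")
  case True
  then have "R1 *v x = 0" "R1 *v (Omega0 *v x) = 0"
    using homog_eq_0 R1_homog Omega0_preserves_homog[OF x] x by blast+
  then show ?thesis by simp
next
  case False
  then have b: "Suc i \<le> k" "j \<le> h" by auto
  have "Omega0 *v (R1 *v x) = ((q - 1) * weight0 i j) *\<^sub>R (q *\<^sub>R (F0 *v (R1 *v x)))
      + shift0 (Suc i) j *\<^sub>R (R1 *v x)"
    unfolding Omega0_homog[OF R1_homog[OF x]] weight0_Suc by (simp add: mult_ac)
  also have "\<dots> = ((q - 1) * weight0 i j) *\<^sub>R (R1 *v (F0 *v x)) + (shift0 (Suc i) j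
      - (q - 1) * weight0 i j * (defect2 i j - q * defect2 (Suc i) j)) *\<^sub>R (R1 *v x)"
    unfolding F0_R1[OF x] by (simp add: scaleR_add_right scaleR_diff_left algebra_simps)
  finally show ?thesis
    unfolding shift0_Suc_left[OF b] Omega0_homog[OF x]
    by (simp add: matrix_vector_right_distrib matrix_mult_vec_scaleR)
qed

lemma Omega0_L2_homog:
  assumes x: "x \<in> homog i j"
  shows "Omega0 *v (L2 *v x) = L2 *v (Omega0 *v x)"
proof (cases "j = 0 \<or> k < i")
  case True
  then have "L2 *v x = 0" "L2 *v (Omega0 *v x) = 0"
    using L2_homog_0 homog_eq_0 Omega0_preserves_homog[OF x] x by (metis matrix_vector_mult_0_right)+
  then show ?thesis by simp
next
  case False
  then obtain b where j: "j = Suc b" and i: "i \<le> k" by (cases j) auto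
  have "Omega0 *v (L2 *v x) = ((q - 1) * weight0 i (Suc b)) *\<^sub>R (q *\<^sub>R (F0 *v (L2 *v x)))
      + shift0 i b *\<^sub>R (L2 *v x)"
    unfolding Omega0_homog[OF L2_homog[OF x[unfolded j]]] weight0_Suc(2)[of i b, symmetric]
    by (simp add: mult_ac)
  also have "\<dots> = ((q - 1) * weight0 i (Suc b)) *\<^sub>R (L2 *v (F0 *v x)) + (shift0 i b
      + (q - 1) * weight0 i (Suc b) * (q * defect1 i b - defect1 i (Suc b))) *\<^sub>R (L2 *v x)"
    unfolding F0_L2[OF x[unfolded j]] by (simp add: scaleR_add_right scaleR_add_left)
  finally show ?thesis
    unfolding shift0_Suc_right[OF i] Omega0_homog[OF x] j
    by (simp add: matrix_vector_right_distrib matrix_mult_vec_scaleR)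
qed

lemma Omega0_R2_homog:
  assumes x: "x \<in> homog i j"
  shows "Omega0 *v (R2 *v x) = R2 *v (Omega0 *v x)"
proof (cases "k < i")
  case True
  then have "R2 *v x = 0" "R2 *v (Omega0 *v x) = 0"
    using homog_eq_0 Omega0_preserves_homog[OF x] x by (metis matrix_vector_mult_0_right)+
  then show ?thesis by simp
next
  case False
  then have i: "i \<le> k" by simp
  have "Omega0 *v (R2 *v x) = ((q - 1) * weight0 i j) *\<^sub>R (R2 *v (F0 *v x)) + (shift0 i (Suc j)
      - (q - 1) * weight0 i (Suc j) * (q * defect1 i j - defect1 i (Suc j))) *\<^sub>R (R2 *v x)"
    unfolding Omega0_homog[OF R2_homog[OF x]] F0_R2[OF x] weight0_Suc(2)[of i j, symmetric]
    by (simp add: scaleR_add_right scaleR_diff_left algebra_simps)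
  then show ?thesis
    unfolding shift0_Suc_right[OF i] Omega0_homog[OF x]
    by (simp add: matrix_vector_right_distrib matrix_mult_vec_scaleR)
qed

lemma Omega0_commutes_generators:
  assumes A: "A \<in> {L1, L2, R1, R2, K1, K1inv, K2, K2inv}" and x: "x \<in> V"
  shows "Omega0 *v (A *v x) = A *v (Omega0 *v x)"
proof -
  have "(Omega0 ** A) *v x = (A ** Omega0) *v x"
  proof (rule mult_vec_eqI_V[OF _ x])
    fix i j z assume z: "z \<in> homog i j"
    have "Omega0 *v (K *v z) = K *v (Omega0 *v z)" if "K \<in> {K1, K1inv, K2, K2inv}" for K
      using that by (auto simp: K_homog[OF z] K_homog[OF Omega0_preserves_homog[OF z]] matrix_mult_vec_scaleR)
    then have "Omega0 *v (A *v z) = A *v (Omega0 *v z)"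
      using A Omega0_L1_homog[OF z] Omega0_R1_homog[OF z] Omega0_L2_homog[OF z] Omega0_R2_homog[OF z]
      by blast
    then show "(Omega0 ** A) *v z = (A ** Omega0) *v z" by (simp add: matrix_vector_mul_assoc)
  qed
  then show ?thesis by (simp add: matrix_vector_mul_assoc)
qed

end

section \<open>Weight spaces of a submodule\<close>

context fixed_subspace
begin

definition weight_space :: "(complex^'v set) set \<Rightarrow> nat \<Rightarrow> nat \<Rightarrow> (complex^'v set) set" where
  "weight_space W i j = W \<inter> homog i j"

lemma gen_mult_vec_mem:
  assumes "H_submodule W" "A \<in> {L1, L2, R1, R2, K1, K1inv, K2, K2inv}" "w \<in> W"
  shows "A *v w \<in> W"
  using assms algH.gen by (auto simp: H_submodule_def)

lemma scaleR_mem: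
  assumes "vec.subspace W" "w \<in> (W :: (complex^'n) set)"
  shows "c *\<^sub>R w \<in> W"
  unfolding of_real_scale_eq_scaleR[symmetric] using assms by (rule vec.subspace_scale)

lemma diag_P_mult_vec_prod:
  "x \<in> V \<Longrightarrow> diag_P (\<lambda>u. (d u - c) * e u) *v x = diag_P d *v (diag_P e *v x) - c *\<^sub>R (diag_P e *v x)"
  by (auto simp: vec_eq_iff diag_P_mult_vec scaleR_conv_of_real[where 'a = complex] algebra_simps V_def)

text \<open>A submodule contains the block components of its elements: the two weights take different
  values on different blocks, so the projection to a block is a Lagrange interpolation polynomial
  in \<open>K1\<close> and \<open>K2\<close>.\<close>

lemma Estar_mult_vec_mem:
  assumes sub: "H_submodule W" and w: "w \<in> W"
  shows "Estar i j *v w \<in> W"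
proof -
  have W: "vec.subspace W" "W \<subseteq> V" using sub by (auto simp: H_submodule_def)
  have prod: "diag_P (\<lambda>u. (\<Prod>c\<in>C. d u - c) * e u) *v w \<in> W"
    if "finite C" "diag_P d \<in> {K1, K2}" "diag_P e *v w \<in> W" for C d e
    using that(1)
  proof (induction C)
    case empty
    then show ?case using that by simp
  next
    case (insert c C)
    let ?x = "diag_P (\<lambda>u. (\<Prod>c\<in>C. d u - c) * e u) *v w"
    have "diag_P (\<lambda>u. (\<Prod>c\<in>insert c C. d u - c) * e u) *v w = diag_P d *v ?x - c *\<^sub>R ?x"
      using insert.hyps diag_P_mult_vec_prod[of w d c "\<lambda>u. (\<Prod>c\<in>C. d u - c) * e u"] w W
      by (simp add: mult.assoc subset_iff)
    moreover have "diag_P d *v ?x \<in> W"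
      using gen_mult_vec_mem[OF sub _ insert.IH, of "diag_P d"] that(2) by blast
    ultimately show ?case using insert.IH scaleR_mem[OF W(1)] vec.subspace_diff[OF W(1)] by simp
  qed
  define a where "a m = q powr (real k / 2 - real m)" for m
  define b where "b m = q powr (real m - real h / 2)" for m
  have "q > 0" "q \<noteq> 1" using q_ge_2 by auto
  then have inj: "inj a" "inj b" unfolding inj_def a_def b_def by (auto simp: powr_inj)
  let ?A = "a ` ({..k} - {i})" and ?B = "b ` ({..h} - {j})"
  \<comment> \<open>The two products vanish at all weights except the one of the block of \<open>i\<close> and \<open>j\<close>.\<close>
  define g where "g u = (\<Prod>c\<in>?A. wt1 u - c) * ((\<Prod>c\<in>?B. wt2 u - c) * 1)" for u
  have "diag_P (\<lambda>u. 1) *v w = w"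
    using w W by (auto simp: vec_eq_iff diag_P_mult_vec V_def)
  then have "diag_P g *v w \<in> W"
    unfolding g_def using w by (intro prod) (auto simp: K1_def K2_def)
  define s where "s = (\<Prod>c\<in>?A. a i - c) * ((\<Prod>c\<in>?B. b j - c) * 1)"
  have "s \<noteq> 0" using inj by (auto simp: s_def inj_def)
  have "diag_P g *v w = s *\<^sub>R (Estar i j *v w)"
  proof (unfold vec_eq_iff, intro allI)
    fix u
    show "(diag_P g *v w) $ u = (s *\<^sub>R (Estar i j *v w)) $ u"
    proof (cases "u \<in> P")
      case False
      then show ?thesis by (simp add: diag_P_mult_vec Estar_mult_vec P_part_def)
    next
      case True
      define i' j' where "i' = dim (u \<inter> y)" and "j' = dim u - dim (u \<inter> y)"
      have le: "dim (u \<inter> y) \<le> dim u" by (rule fd.dim_subset) blast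
      have u: "u \<in> P_part m n \<longleftrightarrow> m = i' \<and> n = j'" for m n
        using True le unfolding i'_def j'_def P_part_def by auto
      have bd: "i' \<le> k" "j' \<le> h" using u P_part_bounds[of u i' j'] by auto
      have wt: "wt1 u = a i'" "wt2 u = b j'"
        using le by (simp_all add: wt1_def wt2_def a_def b_def i'_def j'_def of_nat_diff)
      have "g u = (if i' = i \<and> j' = j then s else 0)"
        using bd by (auto simp: g_def s_def wt)
      then show ?thesis using True u
        by (auto simp: diag_P_mult_vec Estar_mult_vec scaleR_conv_of_real[where 'a = complex])
    qed
  qed
  then have "Estar i j *v w = (1 / s) *\<^sub>R (diag_P g *v w)" using \<open>s \<noteq> 0\<close> by simp
  then show ?thesis using scaleR_mem[OF W(1) \<open>diag_P g *v w \<in> W\<close>] by simp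
qed

lemma Estar_image_eq_weight_space:
  assumes "H_submodule W"
  shows "Estar_image i j W = weight_space W i j"
proof (intro equalityI subsetI)
  fix x assume "x \<in> Estar_image i j W"
  then show "x \<in> weight_space W i j"
    using Estar_mult_vec_mem[OF assms] Estar_mult_vec_homog by (auto simp: Estar_image_def weight_space_def)
next
  fix x assume "x \<in> weight_space W i j"
  then show "x \<in> Estar_image i j W"
    using Estar_fixes_homog by (force simp: Estar_image_def weight_space_def)
qed

lemma weight_space_subspace:
  assumes "H_submodule W"
  shows "vec.subspace (weight_space W i j)"
  unfolding weight_space_def using assms homog_subspace
  by (auto simp: H_submodule_def intro: vec.subspace_inter)

lemma weight_space_maps:
  assumes "H_submodule W" and w: "w \<in> weight_space W i j"
  shows "R1 *v w \<in> weight_space W (Suc i) j" "R2 *v w \<in> weight_space W i (Suc j)"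
    and "i = Suc m \<Longrightarrow> L1 *v w \<in> weight_space W m j" "j = Suc n \<Longrightarrow> L2 *v w \<in> weight_space W i n"
  using w gen_mult_vec_mem[OF assms(1)] R1_homog R2_homog L1_homog L2_homog
  by (auto simp: weight_space_def)

text \<open>Although \<open>F0\<close> is not a generator, the commutator formula shows that submodules are closed
  under it.\<close>

lemma F0_weight_space:
  assumes sub: "H_submodule W" and w: "w \<in> weight_space W i j"
  shows "F0 *v w \<in> weight_space W i j"
proof -
  have W: "vec.subspace W" using sub by (auto simp: H_submodule_def)
  have x: "w \<in> homog i j" "w \<in> W" using w by (auto simp: weight_space_def)
  have "L1 *v (R1 *v w) \<in> W" "R1 *v (L1 *v w) \<in> W" using gen_mult_vec_mem[OF sub] x by auto
  then have "F0 *v w \<in> W" unfolding F0_homog_commutator1[OF x(1)]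
    by (intro vec.subspace_add[OF W] vec.subspace_diff[OF W] scaleR_mem[OF W] x)
  then show ?thesis using F0_homog[OF x(1)] by (simp add: weight_space_def)
qed

end

section \<open>Ladders of one-dimensional spaces\<close>

text \<open>Between neighbouring lines, \<open>D U\<close> and \<open>U D\<close> act by the same scalar (they have the same
  trace), so one sequence of scalars, vanishing at both ends, describes all these products.\<close>

lemma ladder_scalars:
  fixes U D :: "complex^'n^'n" and S :: "nat \<Rightarrow> (complex^'n) set"
  assumes se: "s \<le> e"
    and line: "\<And>i. s \<le> i \<Longrightarrow> i \<le> e \<Longrightarrow> \<exists>b. b \<noteq> 0 \<and> S i = range (\<lambda>c. c *s b)"
    and U: "\<And>i w. s \<le> i \<Longrightarrow> i < e \<Longrightarrow> w \<in> S i \<Longrightarrow> U *v w \<in> S (Suc i)"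
    and D: "\<And>i w. s \<le> i \<Longrightarrow> i < e \<Longrightarrow> w \<in> S (Suc i) \<Longrightarrow> D *v w \<in> S i"
    and U_top: "\<And>w. w \<in> S e \<Longrightarrow> U *v w = 0"
    and D_bot: "\<And>w. w \<in> S s \<Longrightarrow> D *v w = 0"
  obtains a where "a s = 0" "a (Suc e) = 0"
    "\<And>i w. s \<le> i \<Longrightarrow> i \<le> e \<Longrightarrow> w \<in> S i \<Longrightarrow> U *v (D *v w) = a i *s w"
    "\<And>i w. s \<le> i \<Longrightarrow> i \<le> e \<Longrightarrow> w \<in> S i \<Longrightarrow> D *v (U *v w) = a (Suc i) *s w"
proof -
  obtain b where b: "\<And>i. s \<le> i \<Longrightarrow> i \<le> e \<Longrightarrow> b i \<noteq> 0 \<and> S i = range (\<lambda>c. c *s b i)"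
    using line by metis
  have bS: "b i \<in> S i" if "s \<le> i" "i \<le> e" for i
    using b[OF that] rangeI[of "\<lambda>c. c *s b i" 1] by simp
  have "\<exists>c. D *v b (Suc i) = c *s b i" if "s \<le> i" "i < e" for i
    using D[OF that bS[of "Suc i"]] b[of i] that by auto
  then obtain d where d: "\<And>i. s \<le> i \<Longrightarrow> i < e \<Longrightarrow> D *v b (Suc i) = d i *s b i" by metis
  have "\<exists>c. U *v b i = c *s b (Suc i)" if "s \<le> i" "i < e" for i
    using U[OF that bS[of i]] b[of "Suc i"] that by auto
  then obtain p where p: "\<And>i. s \<le> i \<Longrightarrow> i < e \<Longrightarrow> U *v b i = p i *s b (Suc i)" by metis
  define a where "a i = (if s < i \<and> i \<le> e then d (i - 1) * p (i - 1) else 0)" for i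
  have UD: "U *v (D *v b i) = a i *s b i" if i: "s \<le> i" "i \<le> e" for i
  proof (cases "i = s")
    case True
    then show ?thesis using D_bot bS i by (simp add: a_def)
  next
    case False
    then obtain m where "i = Suc m" "s \<le> m" "m < e" using i by (cases i) auto
    then show ?thesis using d p by (simp add: a_def vec.scale vector_scalar_commute)
  qed
  have DU: "D *v (U *v b i) = a (Suc i) *s b i" if i: "s \<le> i" "i \<le> e" for i
  proof (cases "i = e")
    case True
    then show ?thesis using U_top bS i by (simp add: a_def)
  next
    case False
    then have "s \<le> i" "i < e" using i by auto
    then show ?thesis using d p by (simp add: a_def vector_scalar_commute mult.commute)
  qed
  have UD': "U *v (D *v w) = a i *s w" and DU': "D *v (U *v w) = a (Suc i) *s w"
    if i: "s \<le> i" "i \<le> e" and w: "w \<in> S i" for i w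
  proof -
    obtain c where "w = c *s b i" using b[OF i] w by auto
    then show "U *v (D *v w) = a i *s w" "D *v (U *v w) = a (Suc i) *s w"
      using UD[OF i] DU[OF i] by (simp_all add: vector_scalar_commute mult.commute)
  qed
  show thesis by (rule that[of a]) (use UD' DU' in \<open>auto simp: a_def\<close>)
qed

text \<open>The increments are a combination of two geometric sequences, so the sums are again such
  combinations; the factor \<open>(Q - 1)\<^sup>2\<close> clears the denominators of the increments and of the
  geometric sums.\<close>

lemma geometric_telescope:
  fixes Q :: "'a::field"
  assumes "Q \<noteq> 0" and start: "a s = 0"
    and step: "\<And>i. s \<le> i \<Longrightarrow> i \<le> e \<Longrightarrow> (Q - 1) * (a (Suc i) - a i) = A / Q ^ i - B * Q ^ i"
    and "s \<le> i" "i \<le> Suc e"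
  shows "(Q - 1)\<^sup>2 * a i = A * Q * (1 / Q ^ s - 1 / Q ^ i) - B * (Q ^ i - Q ^ s)"
  using assms(4,5)
proof (induction i rule: dec_induct)
  case base
  then show ?case using start by simp
next
  case (step i)
  have "(Q - 1)\<^sup>2 * a (Suc i) = (Q - 1)\<^sup>2 * a i + (Q - 1) * ((Q - 1) * (a (Suc i) - a i))"
    by (simp add: power2_eq_square algebra_simps)
  also have "\<dots> = A * Q * (1 / Q ^ s - 1 / Q ^ i) - B * (Q ^ i - Q ^ s)
      + (Q - 1) * (A / Q ^ i - B * Q ^ i)"
    using step assms(3)[of i] by simp
  also have "\<dots> = A * Q * (1 / Q ^ s - 1 / Q ^ Suc i) - B * (Q ^ Suc i - Q ^ s)"
    using \<open>Q \<noteq> 0\<close> by (simp add: field_simps)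
  finally show ?case .
qed

lemma line_if_dim_1:
  assumes "vec.subspace S" "vec.dim S = 1"
  shows "\<exists>b. b \<noteq> 0 \<and> S = range (\<lambda>c. c *s b)"
proof -
  obtain B where B: "B \<subseteq> S" "vec.independent B" "S \<subseteq> vec.span B" "card B = vec.dim S"
    using vec.basis_exists by blast
  then obtain b where b: "B = {b}" using assms(2) by (auto simp: card_1_singleton_iff)
  have "vec.span B = S" using B(1,3) vec.span_minimal[OF B(1) assms(1)] by blast
  moreover have "b \<noteq> 0" using B(2) b by auto
  ultimately show ?thesis using b vec.span_singleton by metis
qed

section \<open>The scalars on a module of given type\<close>

locale typed_module = fixed_subspace scale q y h k
  for scale :: "'f::{field,finite} \<Rightarrow> 'v::{ab_group_add,finite} \<Rightarrow> 'v"
    and q :: real and y :: "'v set" and h k :: nat +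
  fixes W :: "(complex^'v set) set" and \<alpha> \<beta> \<rho> :: nat
  assumes irreducible: "irreducible_H_module W" and type: "has_type W \<alpha> \<beta> \<rho>"
begin

lemma submodule: "H_submodule W"
  using irreducible by (simp add: irreducible_H_module_def)

lemma W_subspace: "vec.subspace W" and W_subset_V: "W \<subseteq> V"
  using submodule by (auto simp: H_submodule_def)

lemma type_bounds: "\<rho> + 2 * \<alpha> \<le> k" "\<rho> + 2 * \<beta> \<le> h"
  using type by (auto simp: has_type_def)

lemma rectangle_nonempty: "\<alpha> \<le> k - \<rho> - \<alpha>" "\<rho> + \<beta> \<le> h - \<beta>"
  using type_bounds by arith+

abbreviation in_rectangle :: "nat \<Rightarrow> nat \<Rightarrow> bool" where
  "in_rectangle i j \<equiv> \<alpha> \<le> i \<and> i \<le> k - \<rho> - \<alpha> \<and> \<rho> + \<beta> \<le> j \<and> j \<le> h - \<beta>"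

lemma weight_space_line:
  assumes "in_rectangle i j"
  shows "\<exists>b. b \<noteq> 0 \<and> weight_space W i j = range (\<lambda>c. c *s b)"
proof (rule line_if_dim_1[OF weight_space_subspace[OF submodule]])
  have "i \<le> k" "j \<le> h" using assms by auto
  then show "vec.dim (weight_space W i j) = 1"
    using type assms unfolding has_type_def Estar_image_eq_weight_space[OF submodule] by simp
qed

lemma weight_space_outside:
  assumes "\<not> in_rectangle i j" and w: "w \<in> weight_space W i j"
  shows "w = 0"
proof (cases "i \<le> k \<and> j \<le> h")
  case True
  then have "vec.dim (weight_space W i j) = 0"
    using type assms unfolding has_type_def Estar_image_eq_weight_space[OF submodule] by simp
  then show ?thesis using w by (auto simp: vec.dim_eq_0)
next
  case False
  then show ?thesis using w homog_eq_0[of i j w] by (auto simp: weight_space_def)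
qed

text \<open>Schur's lemma: the eigenspace of a scalar found on a single one-dimensional weight space is
  a nonzero submodule, hence all of \<open>W\<close>.\<close>

lemma Omega0_scalar: "\<exists>c. \<forall>w\<in>W. Omega0 *v w = c *s w"
proof -
  let ?S = "weight_space W \<alpha> (\<rho> + \<beta>)"
  have corner: "in_rectangle \<alpha> (\<rho> + \<beta>)" using rectangle_nonempty by simp
  then obtain b where b: "b \<noteq> 0" "?S = range (\<lambda>c. c *s b)"
    using weight_space_line[OF corner] by blast
  have bS: "b \<in> ?S" using b(2) rangeI[of "\<lambda>c. c *s b" 1] by simp
  then have bh: "b \<in> homog \<alpha> (\<rho> + \<beta>)" and bW: "b \<in> W" by (auto simp: weight_space_def)
  have "Omega0 *v b \<in> ?S"
    unfolding Omega0_homog[OF bh] using F0_weight_space[OF submodule bS] bS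
    by (intro vec.subspace_add[OF weight_space_subspace[OF submodule]]
        scaleR_mem[OF weight_space_subspace[OF submodule]])
  then obtain c where c: "Omega0 *v b = c *s b" using b by auto
  define W' where "W' = {w \<in> W. Omega0 *v w = c *s w}"
  have W': "vec.subspace W'"
    using W_subspace unfolding W'_def vec.subspace_def
    by (auto simp: matrix_vector_right_distrib vector_scalar_commute vec.scale_right_distrib mult.commute)
  have closed: "\<forall>w\<in>W'. A *v w \<in> W'" if "A \<in> algH" for A
    using that
  proof (induction A rule: algH.induct)
    case (gen A)
    show ?case
    proof
      fix w assume w: "w \<in> W'"
      then have "w \<in> W" "w \<in> V" using W_subset_V by (auto simp: W'_def)
      moreover have "Omega0 *v (A *v w) = c *s (A *v w)"
        using Omega0_commutes_generators[OF gen \<open>w \<in> V\<close>] w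
        by (simp add: W'_def vector_scalar_commute)
      ultimately show "A *v w \<in> W'" using gen_mult_vec_mem[OF submodule gen] by (simp add: W'_def)
    qed
  next
    case (add A B)
    then show ?case using vec.subspace_add[OF W'] by (simp add: matrix_vector_mult_add_rdistrib)
  next
    case (smult A d)
    have "mat d *v x = d *s x" for x :: "complex^'v set"
      by (auto simp: vec_eq_iff matrix_vector_mult_def mat_def if_distrib[of "\<lambda>z. z * _"] cong: if_cong)
    then show ?case using smult vec.subspace_scale[OF W'] by (simp add: matrix_vector_mul_assoc[symmetric])
  next
    case (mult A B)
    then show ?case by (simp add: matrix_vector_mul_assoc[symmetric])
  qed
  have "W' \<subseteq> W" by (auto simp: W'_def)
  then have "H_submodule W'" using W' closed W_subset_V by (auto simp: H_submodule_def)
  moreover have "W' \<noteq> {0}" using b(1) bW c by (auto simp: W'_def)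
  ultimately have "W' = W" using irreducible \<open>W' \<subseteq> W\<close> by (auto simp: irreducible_H_module_def)
  then show ?thesis by (auto simp: W'_def)
qed

definition omega0 :: complex where
  "omega0 = (SOME c. \<forall>w\<in>W. Omega0 *v w = c *s w)"

lemma Omega0_omega0: "w \<in> W \<Longrightarrow> Omega0 *v w = omega0 *s w"
  unfolding omega0_def by (rule bspec[OF someI_ex[OF Omega0_scalar]])

lemma F0_omega0:
  assumes "w \<in> weight_space W i j"
  shows "complex_of_real ((q - 1) * weight0 i j) *s (F0 *v w) = (omega0 - of_real (shift0 i j)) *s w"
proof -
  have w: "w \<in> homog i j" "w \<in> W" using assms by (auto simp: weight_space_def)
  show ?thesis using Omega0_homog[OF w(1)] Omega0_omega0[OF w(2)]
    by (simp add: of_real_scale_eq_scaleR vec.scale_left_diff_distrib del: of_real_mult)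
qed

lemma weight_space_nonzero:
  assumes "in_rectangle i j"
  obtains b where "b \<in> weight_space W i j" "b \<noteq> 0"
proof -
  obtain b where b: "b \<noteq> 0" "weight_space W i j = range (\<lambda>c. c *s b)"
    using weight_space_line[OF assms] by blast
  then have "b \<in> weight_space W i j" using rangeI[of "\<lambda>c. c *s b" 1] by simp
  then show thesis using that b by blast
qed

lemma L1_bottom: "w \<in> weight_space W \<alpha> j \<Longrightarrow> L1 *v w = 0"
  using weight_space_maps(3)[OF submodule, of w \<alpha> j "\<alpha> - 1"] weight_space_outside[of "\<alpha> - 1" j]
    L1_homog_0 by (cases \<alpha>) (auto simp: weight_space_def)

lemma L2_bottom: "w \<in> weight_space W i (\<rho> + \<beta>) \<Longrightarrow> L2 *v w = 0"
  using weight_space_maps(4)[OF submodule, of w i "\<rho> + \<beta>" "\<rho> + \<beta> - 1"]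
    weight_space_outside[of i "\<rho> + \<beta> - 1"] L2_homog_0
  by (cases "\<rho> + \<beta>") (auto simp: weight_space_def)

lemma R1_top: "w \<in> weight_space W (k - \<rho> - \<alpha>) j \<Longrightarrow> R1 *v w = 0"
  using weight_space_maps(1)[OF submodule] weight_space_outside[of "Suc (k - \<rho> - \<alpha>)" j] by simp

lemma R2_top: "w \<in> weight_space W i (h - \<beta>) \<Longrightarrow> R2 *v w = 0"
  using weight_space_maps(2)[OF submodule] weight_space_outside[of i "Suc (h - \<beta>)"] by simp

lemma scalar_from_omega0:
  fixes Q I J K c t :: "'b::field"
  assumes nz: "I \<noteq> 0" "J \<noteq> 0" "K \<noteq> 0"
    and eq: "(Q - 1) * (I / (J * K)) * t = c - (I / K + 1 / J - I / (J * K))"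
  shows "(Q - 1) * t = c * K * J / I - J - K / I + 1"
proof -
  have "(Q - 1) * t = (J * K / I) * ((Q - 1) * (I / (J * K)) * t)" using nz by simp
  also have "\<dots> = c * K * J / I - J - K / I + 1" unfolding eq using nz by (simp add: field_simps)
  finally show ?thesis .
qed

text \<open>A row of the rectangle is a ladder for \<open>R1\<close> and \<open>L1\<close>.  The increments of its scalars are the
  values of the commutator, that is, of \<open>F0\<close> up to a known scalar, and these are given by the
  scalar of \<open>Omega0\<close>.\<close>

lemma ladder_slash:
  assumes j: "\<rho> + \<beta> \<le> j" "j \<le> h - \<beta>"
  defines "Q \<equiv> complex_of_real q"
  obtains a where "a \<alpha> = 0" "a (Suc (k - \<rho> - \<alpha>)) = 0"
    "\<And>i w. in_rectangle i j \<Longrightarrow> w \<in> weight_space W i j \<Longrightarrow> R1 *v (L1 *v w) = a i *s w"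
    "\<And>i. in_rectangle i j \<Longrightarrow>
      (Q - 1) * (a (Suc i) - a i) = omega0 * Q ^ k * Q ^ j / Q ^ i - Q ^ j * Q ^ i"
proof -
  let ?e = "k - \<rho> - \<alpha>"
  have "\<alpha> \<le> ?e" by (rule rectangle_nonempty)
  then obtain a where a: "a \<alpha> = 0" "a (Suc ?e) = 0"
    and UD: "\<And>i w. \<alpha> \<le> i \<Longrightarrow> i \<le> ?e \<Longrightarrow> w \<in> weight_space W i j \<Longrightarrow> R1 *v (L1 *v w) = a i *s w"
    and DU: "\<And>i w. \<alpha> \<le> i \<Longrightarrow> i \<le> ?e \<Longrightarrow> w \<in> weight_space W i j \<Longrightarrow> L1 *v (R1 *v w) = a (Suc i) *s w"
    by (rule ladder_scalars[of \<alpha> ?e "\<lambda>i. weight_space W i j" R1 L1])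
      (use j weight_space_line weight_space_maps[OF submodule] L1_bottom R1_top in auto)
  have "(Q - 1) * (a (Suc i) - a i) = omega0 * Q ^ k * Q ^ j / Q ^ i - Q ^ j * Q ^ i"
    if r: "in_rectangle i j" for i
  proof -
    obtain b where b: "b \<in> weight_space W i j" "b \<noteq> 0" using weight_space_nonzero[OF r] .
    then have bh: "b \<in> homog i j" by (simp add: weight_space_def)
    have F0b: "F0 *v b = (a (Suc i) - a i + of_real (defect1 i j)) *s b"
      using F0_homog_commutator1[OF bh] UD[of i b] DU[of i b] r b
      by (simp add: of_real_scale_eq_scaleR[symmetric] vec.scale_left_diff_distrib vec.scale_left_distrib)
    have "complex_of_real ((q - 1) * weight0 i j) * (a (Suc i) - a i + of_real (defect1 i j))
        = omega0 - of_real (shift0 i j)"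
      using F0_omega0[OF b(1)] unfolding F0b vec.scale_scale by (rule vec.scale_right_imp_eq[OF b(2)])
    moreover have Qnz: "Q \<noteq> 0" using q_ge_2 by (simp add: Q_def)
    have "i \<le> k" using r by linarith
    then have defect: "(Q - 1) * of_real (defect1 i j) = Q ^ i * Q ^ j - Q ^ j - Q ^ k / Q ^ i + 1"
      using arg_cong[OF q_minus_1_defect1[of i j], of complex_of_real] by (simp add: Q_def)
    ultimately have "(Q - 1) * (a (Suc i) - a i + of_real (defect1 i j))
        = omega0 * Q ^ k * Q ^ j / Q ^ i - Q ^ j - Q ^ k / Q ^ i + 1"
      by (intro scalar_from_omega0) (simp_all add: Qnz weight0_def shift0_def Q_def[symmetric])
    then show ?thesis using defect unfolding distrib_left[of "Q - 1"]
      by (simp add: eq_diff_eq mult.commute[of "Q ^ j" "Q ^ i"])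
  qed
  then show thesis using that[of a] a UD by blast
qed

text \<open>A column is a ladder for \<open>R2\<close> and \<open>L2\<close>, where the commutator occurs with the opposite sign.\<close>

lemma ladder_backslash:
  assumes i: "\<alpha> \<le> i" "i \<le> k - \<rho> - \<alpha>"
  defines "Q \<equiv> complex_of_real q"
  obtains a where "a (\<rho> + \<beta>) = 0"
    "\<And>j w. in_rectangle i j \<Longrightarrow> w \<in> weight_space W i j \<Longrightarrow> L2 *v (R2 *v w) = a (Suc j) *s w"
    "\<And>j. in_rectangle i j \<Longrightarrow>
      (Q - 1) * (a (Suc j) - a j) = Q ^ h * Q ^ k / Q ^ i / Q ^ j - omega0 * Q ^ k / Q ^ i * Q ^ j"
proof -
  let ?s = "\<rho> + \<beta>" and ?e = "h - \<beta>"
  have "?s \<le> ?e" by (rule rectangle_nonempty)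
  then obtain a where a: "a ?s = 0"
    and UD: "\<And>j w. ?s \<le> j \<Longrightarrow> j \<le> ?e \<Longrightarrow> w \<in> weight_space W i j \<Longrightarrow> R2 *v (L2 *v w) = a j *s w"
    and DU: "\<And>j w. ?s \<le> j \<Longrightarrow> j \<le> ?e \<Longrightarrow> w \<in> weight_space W i j \<Longrightarrow> L2 *v (R2 *v w) = a (Suc j) *s w"
    by (rule ladder_scalars[of ?s ?e "\<lambda>j. weight_space W i j" R2 L2])
      (use i weight_space_line weight_space_maps[OF submodule] L2_bottom R2_top in auto)
  have "(Q - 1) * (a (Suc j) - a j) = Q ^ h * Q ^ k / Q ^ i / Q ^ j - omega0 * Q ^ k / Q ^ i * Q ^ j"
    if r: "in_rectangle i j" for j
  proof -
    obtain b where b: "b \<in> weight_space W i j" "b \<noteq> 0" using weight_space_nonzero[OF r] .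
    then have bh: "b \<in> homog i j" by (simp add: weight_space_def)
    have F0b: "F0 *v b = (a j - a (Suc j) + of_real (defect2 i j)) *s b"
      using F0_homog_commutator2[OF bh] UD[of j b] DU[of j b] r b
      by (simp add: of_real_scale_eq_scaleR[symmetric] vec.scale_left_diff_distrib vec.scale_left_distrib)
    have "complex_of_real ((q - 1) * weight0 i j) * (a j - a (Suc j) + of_real (defect2 i j))
        = omega0 - of_real (shift0 i j)"
      using F0_omega0[OF b(1)] unfolding F0b vec.scale_scale by (rule vec.scale_right_imp_eq[OF b(2)])
    moreover have Qnz: "Q \<noteq> 0" using q_ge_2 by (simp add: Q_def)
    have "i \<le> k" "j \<le> h" using r by linarith+
    then have defect: "(Q - 1) * of_real (defect2 i j) = Q ^ h * Q ^ k / (Q ^ i * Q ^ j) - Q ^ k / Q ^ i - Q ^ j + 1"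
      using arg_cong[OF q_minus_1_defect2[of i j], of complex_of_real] by (simp add: Q_def)
    ultimately have "(Q - 1) * (a j - a (Suc j) + of_real (defect2 i j))
        = omega0 * Q ^ k * Q ^ j / Q ^ i - Q ^ j - Q ^ k / Q ^ i + 1"
      by (intro scalar_from_omega0) (simp_all add: Qnz weight0_def shift0_def Q_def[symmetric])
    then have "(Q - 1) * (a j - a (Suc j)) = omega0 * Q ^ k * Q ^ j / Q ^ i - Q ^ h * Q ^ k / (Q ^ i * Q ^ j)"
      using defect unfolding distrib_left[of "Q - 1"] by (simp add: eq_diff_eq)
    moreover have "(Q - 1) * (a (Suc j) - a j) = - ((Q - 1) * (a j - a (Suc j)))"
      by (simp add: algebra_simps)
    ultimately show ?thesis by (simp add: mult_ac)
  qed
  then show thesis using that[of a] a DU by blast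
qed

text \<open>The scalars of a ladder vanish at both ends, so the increments along a row of
  \<open>k - \<rho> - 2 * \<alpha> + 1\<close> blocks sum to zero.  This is a linear equation for the scalar of \<open>Omega0\<close>.\<close>

lemma omega0_eq: "omega0 = 1 / complex_of_real q ^ \<rho>"
proof -
  define Q where "Q = complex_of_real q"
  let ?e = "k - \<rho> - \<alpha>" and ?j = "\<rho> + \<beta>"
  have j: "?j \<le> h - \<beta>" and e: "\<alpha> \<le> ?e" by (rule rectangle_nonempty)+
  have k: "k = \<rho> + (\<alpha> + ?e)" using type_bounds(1) by arith
  obtain a where a: "a \<alpha> = 0" "a (Suc ?e) = 0"
    and step: "\<And>i. in_rectangle i ?j \<Longrightarrow>
      (Q - 1) * (a (Suc i) - a i) = omega0 * Q ^ k * Q ^ ?j / Q ^ i - Q ^ ?j * Q ^ i"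
    using ladder_slash[OF order_refl j] unfolding Q_def by metis
  have Q: "Q \<noteq> 0" using q_ge_2 by (simp add: Q_def)
  have "(Q - 1)\<^sup>2 * a (Suc ?e) = omega0 * Q ^ k * Q ^ ?j * Q * (1 / Q ^ \<alpha> - 1 / Q ^ Suc ?e)
      - Q ^ ?j * (Q ^ Suc ?e - Q ^ \<alpha>)"
    by (rule geometric_telescope[where e = ?e]) (use Q a step e j in auto)
  then have "omega0 * Q ^ k * Q * (1 / Q ^ \<alpha> - 1 / Q ^ Suc ?e) = Q ^ Suc ?e - Q ^ \<alpha>"
    using a(2) Q by (simp add: mult.assoc)
  also have "\<dots> = Q ^ \<alpha> * Q ^ ?e * Q * (1 / Q ^ \<alpha> - 1 / Q ^ Suc ?e)" using Q by (simp add: field_simps)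
  finally have "omega0 * Q ^ k * Q * (1 / Q ^ \<alpha> - 1 / Q ^ Suc ?e)
      = Q ^ \<alpha> * Q ^ ?e * Q * (1 / Q ^ \<alpha> - 1 / Q ^ Suc ?e)" .
  \<comment> \<open>The row is nonempty, so the coefficient of the unknown scalar is not zero.\<close>
  moreover have "q ^ \<alpha> < q ^ Suc ?e" using q_ge_2 e by (intro power_strict_increasing) auto
  then have "q ^ \<alpha> \<noteq> q ^ Suc ?e" by simp
  then have "Q ^ \<alpha> \<noteq> Q ^ Suc ?e" unfolding Q_def by (metis of_real_eq_iff of_real_power)
  then have "1 / Q ^ \<alpha> - 1 / Q ^ Suc ?e \<noteq> 0" using Q by (simp del: power_Suc add: field_simps)
  ultimately have "omega0 * Q ^ k * Q = Q ^ \<alpha> * Q ^ ?e * Q" by (metis mult_cancel_right)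
  then have "omega0 * (Q ^ \<rho> * (Q ^ \<alpha> * Q ^ ?e)) = Q ^ \<alpha> * Q ^ ?e" using Q k by (metis mult_cancel_right power_add)
  then have "omega0 * Q ^ \<rho> = 1" using Q by (simp add: mult.assoc[symmetric])
  then show ?thesis using Q by (simp add: Q_def[symmetric] field_simps)
qed

end

section \<open>Eigenvalues\<close>

text \<open>Here \<open>w\<close> may be zero, so scalars simply compose along a matrix expression and can be read
  off from the definitions of the matrices.\<close>

definition acts :: "complex^'n^'n \<Rightarrow> real \<Rightarrow> complex^'n \<Rightarrow> bool" where
  "acts A c w \<longleftrightarrow> A *v w = c *\<^sub>R w"

lemma acts_add: "acts A a w \<Longrightarrow> acts B b w \<Longrightarrow> acts (A + B) (a + b) w"
  by (simp add: acts_def matrix_vector_mult_add_rdistrib scaleR_add_left)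

lemma acts_diff: "acts A a w \<Longrightarrow> acts B b w \<Longrightarrow> acts (A - B) (a - b) w"
  by (simp add: acts_def matrix_vector_mult_diff_rdistrib scaleR_diff_left)

lemma acts_scaleR: "acts A a w \<Longrightarrow> acts (c *\<^sub>R A) (c * a) w"
  by (simp add: acts_def scaleR_matrix_mult_vec)

lemma acts_uminus: "acts A a w \<Longrightarrow> acts (- A) (- a) w"
  using acts_scaleR[of A a w "-1"] by simp

lemma acts_mult: "acts A a w \<Longrightarrow> acts B b w \<Longrightarrow> acts (A ** B) (a * b) w"
  by (simp add: acts_def matrix_vector_mul_assoc[symmetric] matrix_mult_vec_scaleR mult.commute)

lemmas acts_intros = acts_add acts_diff acts_scaleR acts_uminus acts_mult

context fixed_subspace
begin

text \<open>The half-integral powers of \<open>q\<close> are kept as multiples of \<open>q powr (h / 2)\<close> and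
  \<open>q powr (k / 2)\<close>, which cancel or occur squared in the end.\<close>

lemma powr_normalize:
  "q powr (- real h / 2) = 1 / q powr (real h / 2)"
  "q powr (- real k / 2) = 1 / q powr (real k / 2)"
  "q powr (real h / 2 + 1) = q powr (real h / 2) * q"
  "q powr (real k / 2 + 1) = q powr (real k / 2) * q"
  "q powr ((real h + real k) / 2) = q powr (real h / 2) * q powr (real k / 2)"
  "q powr ((real h + real k) / 2 + 1) = q powr (real h / 2) * q powr (real k / 2) * q"
  "q powr ((real h + real k) / 2 - 1) = q powr (real h / 2) * q powr (real k / 2) / q"
  "q powr ((real h + 3 * real k) / 2 - 1) = q powr (real h / 2) * q powr (real k / 2) * q ^ k / q"
  "q powr (-1) = 1 / q"
  "(q - 1) powr (-1) = 1 / (q - 1)"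
  "(q - 1) powr (-2) = 1 / (q - 1)\<^sup>2"
  "q powr real n = q ^ n"
  "q powr (real n - 1) = q ^ n / q"
  "q powr (real h + real k - 2) = q ^ h * q ^ k / q\<^sup>2"
proof -
  have q: "q > 0" "q - 1 > 0" using q_ge_2 by auto
  show n: "q powr real n = q ^ n" for n using q by (simp add: powr_realpow)
  show "q powr (- real h / 2) = 1 / q powr (real h / 2)" "q powr (- real k / 2) = 1 / q powr (real k / 2)"
    unfolding minus_divide_left[symmetric] powr_minus_divide by simp_all
  show "q powr (real h / 2 + 1) = q powr (real h / 2) * q" "q powr (real k / 2 + 1) = q powr (real k / 2) * q"
    "q powr ((real h + real k) / 2 + 1) = q powr (real h / 2) * q powr (real k / 2) * q"
    "q powr ((real h + real k) / 2 - 1) = q powr (real h / 2) * q powr (real k / 2) / q"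
    using q by (simp_all add: powr_add powr_diff powr_half_h_k)
  show "q powr ((real h + real k) / 2) = q powr (real h / 2) * q powr (real k / 2)"
    by (rule powr_half_h_k)
  have "(real h + 3 * real k) / 2 - 1 = (real h + real k) / 2 + real k - 1" by (simp add: field_simps)
  then show "q powr ((real h + 3 * real k) / 2 - 1) = q powr (real h / 2) * q powr (real k / 2) * q ^ k / q"
    using q by (simp only: powr_diff powr_add powr_half_h_k n) simp
  show "q powr (-1) = 1 / q" "(q - 1) powr (-1) = 1 / (q - 1)" "(q - 1) powr (-2) = 1 / (q - 1)\<^sup>2"
    using q by (simp_all add: powr_minus_divide)
  show "q powr (real n - 1) = q ^ n / q" "q powr (real h + real k - 2) = q ^ h * q ^ k / q\<^sup>2"
    using q by (simp_all add: powr_diff powr_add n)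
qed

lemma acts_K:
  assumes "w \<in> homog i j"
  shows "acts K1 (q powr (real k / 2) / q ^ i) w" "acts K1inv (q ^ i / q powr (real k / 2)) w"
    "acts K2 (q ^ j / q powr (real h / 2)) w" "acts K2inv (q powr (real h / 2) / q ^ j) w"
    "acts Id_P 1 w"
  using K_homog[OF assms] by (simp_all add: acts_def)

end

context typed_module
begin

context
  fixes i j :: nat and w :: "complex^'v set"
  assumes rect: "in_rectangle i j" and w: "w \<in> weight_space W i j"
begin

lemma w_homog: "w \<in> homog i j" and w_mem: "w \<in> W"
  using w by (auto simp: weight_space_def)

lemma acts_Omega0: "acts Omega0 (1 / q ^ \<rho>) w"
proof -
  have "omega0 = of_real (1 / q ^ \<rho>)" by (simp add: omega0_eq)
  then show ?thesis using Omega0_omega0[OF w_mem] by (simp only: acts_def of_real_scale_eq_scaleR)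
qed

lemma acts_F0: "acts F0 ((q ^ k * q ^ j / (q ^ \<rho> * q ^ i) - q ^ j - q ^ k / q ^ i + 1) / (q - 1)) w"
proof -
  have q: "q \<noteq> 0" "q - 1 \<noteq> 0" using q_ge_2 by auto
  let ?z = "(q - 1) * weight0 i j"
  have z: "?z \<noteq> 0" using q by (simp add: weight0_def)
  have "?z *\<^sub>R (F0 *v w) = (1 / q ^ \<rho> - shift0 i j) *\<^sub>R w"
    using Omega0_homog[OF w_homog] acts_Omega0 by (simp add: acts_def scaleR_diff_left eq_diff_eq)
  then have "(1 / ?z) *\<^sub>R (?z *\<^sub>R (F0 *v w)) = (1 / ?z * (1 / q ^ \<rho> - shift0 i j)) *\<^sub>R w" by simp
  then have "F0 *v w = (1 / ?z * (1 / q ^ \<rho> - shift0 i j)) *\<^sub>R w" using z by simp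
  also have "1 / ?z * (1 / q ^ \<rho> - shift0 i j)
      = (q ^ k * q ^ j / (q ^ \<rho> * q ^ i) - q ^ j - q ^ k / q ^ i + 1) / (q - 1)"
    using q by (simp add: weight0_def shift0_def divide_simps) (simp add: algebra_simps)
  finally show ?thesis by (simp add: acts_def)
qed

text \<open>\<open>Fminus\<close> is \<open>R1 L1\<close> minus a scalar, and \<open>R1 L1\<close> is the partial sum, from the left end of
  the row up to \<open>i\<close>, of the increments of the ladder.\<close>

lemma acts_Fminus:
  "acts Fminus ((q ^ k * q ^ j * q / q ^ \<rho> * (1 / q ^ \<alpha> - 1 / q ^ i) - q ^ j * (q ^ i - q ^ \<alpha>)) / (q - 1)\<^sup>2
    - (q ^ i * q ^ j - q ^ j) / (q - 1)) w"
proof -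
  let ?Q = "complex_of_real q"
  let ?c = "(q ^ k * q ^ j * q / q ^ \<rho> * (1 / q ^ \<alpha> - 1 / q ^ i) - q ^ j * (q ^ i - q ^ \<alpha>)) / (q - 1)\<^sup>2"
  have Q: "?Q \<noteq> 0" "?Q - 1 \<noteq> 0" using q_ge_2 by auto
  obtain a where a: "a \<alpha> = 0" "R1 *v (L1 *v w) = a i *s w"
    and step: "\<And>i. in_rectangle i j \<Longrightarrow>
      (?Q - 1) * (a (Suc i) - a i) = omega0 * ?Q ^ k * ?Q ^ j / ?Q ^ i - ?Q ^ j * ?Q ^ i"
    using ladder_slash[of j] rect w by metis
  have "(?Q - 1)\<^sup>2 * a i = omega0 * ?Q ^ k * ?Q ^ j * ?Q * (1 / ?Q ^ \<alpha> - 1 / ?Q ^ i)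
      - ?Q ^ j * (?Q ^ i - ?Q ^ \<alpha>)"
    by (rule geometric_telescope[where e = "k - \<rho> - \<alpha>"]) (use Q a step rect in auto)
  then have "a i = (omega0 * ?Q ^ k * ?Q ^ j * ?Q * (1 / ?Q ^ \<alpha> - 1 / ?Q ^ i)
      - ?Q ^ j * (?Q ^ i - ?Q ^ \<alpha>)) / (?Q - 1)\<^sup>2" using Q by (simp add: eq_divide_eq mult.commute)
  also have "\<dots> = of_real ?c" by (simp add: omega0_eq mult_ac)
  finally have "R1 *v (L1 *v w) = ?c *\<^sub>R w" using a(2) by (simp only: of_real_scale_eq_scaleR)
  moreover have "qnum (i + j) - qnum j = (q ^ i * q ^ j - q ^ j) / (q - 1)"
    by (simp add: qnum_def power_add diff_divide_distrib)
  ultimately show ?thesis by (simp add: Fminus_homog[OF w_homog] acts_def scaleR_diff_left)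
qed

text \<open>Likewise \<open>Fplus\<close> is \<open>L2 R2\<close> minus a scalar.  The product \<open>L2 R2\<close> passes through the block
  above, hence the index \<open>Suc j\<close> in the partial sum.\<close>

lemma acts_Fplus:
  "acts Fplus ((q ^ h * q ^ k / q ^ i * q * (1 / q ^ (\<rho> + \<beta>) - 1 / q ^ Suc j)
      - q ^ k / (q ^ \<rho> * q ^ i) * (q ^ Suc j - q ^ (\<rho> + \<beta>))) / (q - 1)\<^sup>2
    - (q ^ h * q ^ k / (q ^ i * q ^ j) - q ^ k / q ^ i) / (q - 1)) w"
proof -
  let ?Q = "complex_of_real q"
  let ?c = "(q ^ h * q ^ k / q ^ i * q * (1 / q ^ (\<rho> + \<beta>) - 1 / q ^ Suc j)
      - q ^ k / (q ^ \<rho> * q ^ i) * (q ^ Suc j - q ^ (\<rho> + \<beta>))) / (q - 1)\<^sup>2"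
  have Q: "?Q \<noteq> 0" "?Q - 1 \<noteq> 0" using q_ge_2 by auto
  obtain a where a: "a (\<rho> + \<beta>) = 0" "L2 *v (R2 *v w) = a (Suc j) *s w"
    and step: "\<And>j. in_rectangle i j \<Longrightarrow>
      (?Q - 1) * (a (Suc j) - a j) = ?Q ^ h * ?Q ^ k / ?Q ^ i / ?Q ^ j - omega0 * ?Q ^ k / ?Q ^ i * ?Q ^ j"
    using ladder_backslash[of i] rect w by metis
  have "(?Q - 1)\<^sup>2 * a (Suc j) = ?Q ^ h * ?Q ^ k / ?Q ^ i * ?Q * (1 / ?Q ^ (\<rho> + \<beta>) - 1 / ?Q ^ Suc j)
      - omega0 * ?Q ^ k / ?Q ^ i * (?Q ^ Suc j - ?Q ^ (\<rho> + \<beta>))"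
    by (rule geometric_telescope[where e = "h - \<beta>"]) (use Q a step rect in auto)
  then have "a (Suc j) = (?Q ^ h * ?Q ^ k / ?Q ^ i * ?Q * (1 / ?Q ^ (\<rho> + \<beta>) - 1 / ?Q ^ Suc j)
      - omega0 * ?Q ^ k / ?Q ^ i * (?Q ^ Suc j - ?Q ^ (\<rho> + \<beta>))) / (?Q - 1)\<^sup>2"
    using Q by (simp add: eq_divide_eq mult.commute del: power_Suc)
  also have "\<dots> = of_real ?c" by (simp add: omega0_eq mult_ac)
  finally have "L2 *v (R2 *v w) = ?c *\<^sub>R w" using a(2) by (simp only: of_real_scale_eq_scaleR)
  moreover have "i \<le> k" "j \<le> h" using rect by linarith+
  then have "qnum (h + k - (i + j)) - qnum (k - i) = (q ^ h * q ^ k / (q ^ i * q ^ j) - q ^ k / q ^ i) / (q - 1)"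
    by (simp add: qnum_def power_diff_real power_add diff_divide_distrib)
  ultimately show ?thesis
    by (simp add: Fplus_homog[OF w_homog] acts_def scaleR_diff_left del: power_Suc)
qed

end

end

text \<open>The following identities evaluate the definitions of \<open>Omega1\<close> and \<open>Omega2\<close>.  The results do
  not involve \<open>i\<close> and \<open>j\<close>: \<open>Omega1\<close> and \<open>Omega2\<close> are scalars on all of \<open>W\<close>.  Here
  \<open>H\<^sup>2 = q\<^sup>h\<close>, \<open>K\<^sup>2 = q\<^sup>k\<close>, and \<open>I\<close>, \<open>J\<close>, \<open>A\<close>, \<open>B\<close>, \<open>R\<close> stand for the powers of \<open>q\<close> with the
  exponents \<open>i\<close>, \<open>j\<close>, \<open>\<alpha>\<close>, \<open>\<beta>\<close>, \<open>\<rho>\<close>.\<close>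

lemma Omega1_coefficient:
  fixes q H K I J A R :: real
  assumes nz: "q \<noteq> 0" "q - 1 \<noteq> 0" "H \<noteq> 0" "K \<noteq> 0" "I \<noteq> 0" "J \<noteq> 0" "A \<noteq> 0" "R \<noteq> 0"
    and f: "f = (K * K * J / (R * I) - J - K * K / I + 1) / (q - 1)"
    and m: "m = (K * K * J * q / R * (1 / A - 1 / I) - J * (I - A)) / (q - 1)\<^sup>2 - (I * J - J) / (q - 1)"
  shows "1 / H * (q * (f * (H / J)) + (q - 1) * (m * (H / J))
      + 1 / (q - 1) * (K * q * (K / I * (H / J)) + H * K * q * (I / K) - q * (H / J))) - q / (q - 1) * 1
    = (q * (K * K) / (A * R) + A - q - 1) / (q - 1)"
proof -
  define d where "d = q - 1"
  have d: "q - 1 = d" "d \<noteq> 0" using nz by (simp_all add: d_def)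
  have clear: "d * (d * (M / d\<^sup>2 - N / d)) = M - d * N" for M N
    using d(2) by (simp add: power2_eq_square field_simps)
  have "1 / H * (q * (f * (H / J)) + d * (m * (H / J))
      + 1 / d * (K * q * (K / I * (H / J)) + H * K * q * (I / K) - q * (H / J))) - q / d * 1
    = (q * (d * f) + d * (d * m)) / J / d + (q * (K * K) / (I * J) + q * I - q / J - q) / d"
    using nz d by (simp add: field_simps)
  also have "d * f = K * K * J / (R * I) - J - K * K / I + 1" using d by (simp add: f)
  also have "d * (d * m) = K * K * J * q / R * (1 / A - 1 / I) - J * (I - A) - d * (I * J - J)"
    unfolding m d(1) by (rule clear)
  also have "(q * (K * K * J / (R * I) - J - K * K / I + 1)
        + (K * K * J * q / R * (1 / A - 1 / I) - J * (I - A) - d * (I * J - J))) / J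
      = q * (K * K) / (A * R) - q - q * (K * K) / (I * J) + q / J + A - I - d * (I - 1)"
    using nz by (simp add: field_simps)
  also have "\<dots> / d + (q * (K * K) / (I * J) + q * I - q / J - q) / d
      = (q * (K * K) / (A * R) + A - q - 1) / d"
    unfolding add_divide_distrib[symmetric] by (simp add: d_def algebra_simps)
  finally show ?thesis by (simp only: d(1))
qed

lemma Omega2_coefficient:
  fixes q H K I J B R :: real
  assumes nz: "q \<noteq> 0" "q - 1 \<noteq> 0" "H \<noteq> 0" "K \<noteq> 0" "I \<noteq> 0" "J \<noteq> 0" "B \<noteq> 0" "R \<noteq> 0"
    and f: "f = (K * K * J / (R * I) - J - K * K / I + 1) / (q - 1)"
    and p: "p = (H * H * (K * K) / I * q * (1 / (R * B) - 1 / (q * J)) - K * K / (R * I) * (q * J - R * B)) / (q - 1)\<^sup>2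
      - (H * H * (K * K) / (I * J) - K * K / I) / (q - 1)"
  shows "1 / K * (q * (f * (I / K)) + (q - 1) * (p * (I / K))
      + 1 / (q - 1) * (H * q * (I / K * (J / H)) + H * K * q * (H / J) - q * (I / K))) - q / (q - 1) * 1
    = (q * (H * H) / (R * B) + B - q - 1) / (q - 1)"
proof -
  define d where "d = q - 1"
  have d: "q - 1 = d" "d \<noteq> 0" using nz by (simp_all add: d_def)
  have clear: "d * (d * (M / d\<^sup>2 - N / d)) = M - d * N" for M N
    using d(2) by (simp add: power2_eq_square field_simps)
  have "1 / K * (q * (f * (I / K)) + d * (p * (I / K))
      + 1 / d * (H * q * (I / K * (J / H)) + H * K * q * (H / J) - q * (I / K))) - q / d * 1
    = (q * (d * f) + d * (d * p)) * I / (K * K) / d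
      + (q * I * J / (K * K) + q * (H * H) / J - q * I / (K * K) - q) / d"
    using nz d by (simp add: field_simps)
  also have "d * f = K * K * J / (R * I) - J - K * K / I + 1" using d by (simp add: f)
  also have "d * (d * p) = H * H * (K * K) / I * q * (1 / (R * B) - 1 / (q * J)) - K * K / (R * I) * (q * J - R * B)
      - d * (H * H * (K * K) / (I * J) - K * K / I)"
    unfolding p d(1) by (rule clear)
  also have "(q * (K * K * J / (R * I) - J - K * K / I + 1)
        + (H * H * (K * K) / I * q * (1 / (R * B) - 1 / (q * J)) - K * K / (R * I) * (q * J - R * B)
          - d * (H * H * (K * K) / (I * J) - K * K / I))) * I / (K * K)
      = q * (H * H) / (R * B) - q * I * J / (K * K) - q + q * I / (K * K) - H * H / J + B - d * (H * H / J - 1)"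
    using nz by (simp add: field_simps)
  also have "\<dots> / d + (q * I * J / (K * K) + q * (H * H) / J - q * I / (K * K) - q) / d
      = (q * (H * H) / (R * B) + B - q - 1) / d"
    unfolding add_divide_distrib[symmetric]
    by (rule arg_cong[where f = "\<lambda>x. x / d"]) (use nz in \<open>simp add: d_def field_simps\<close>)
  finally show ?thesis by (simp only: d(1))
qed

context typed_module
begin

context
  fixes i j :: nat and w :: "complex^'v set"
  assumes rect: "in_rectangle i j" and w: "w \<in> weight_space W i j"
begin

lemma acts_Omega1: "acts Omega1 ((q * q ^ k / (q ^ \<alpha> * q ^ \<rho>) + q ^ \<alpha> - q - 1) / (q - 1)) w"
proof -
  let ?H = "q powr (real h / 2)" and ?K = "q powr (real k / 2)"
  let ?I = "q ^ i" and ?J = "q ^ j"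
  define f where "f = (q ^ k * q ^ j / (q ^ \<rho> * q ^ i) - q ^ j - q ^ k / q ^ i + 1) / (q - 1)"
  define m where "m = (q ^ k * q ^ j * q / q ^ \<rho> * (1 / q ^ \<alpha> - 1 / q ^ i) - q ^ j * (q ^ i - q ^ \<alpha>)) / (q - 1)\<^sup>2
    - (q ^ i * q ^ j - q ^ j) / (q - 1)"
  have nz: "q \<noteq> 0" "q - 1 \<noteq> 0" "?H \<noteq> 0" "?K \<noteq> 0" "q ^ n \<noteq> 0" for n
    using q_ge_2 by auto
  have "acts Omega1 (1 / ?H * (q * (f * (?H / ?J)) + (q - 1) * (m * (?H / ?J))
      + 1 / (q - 1) * (?K * q * (?K / ?I * (?H / ?J)) + ?H * ?K * q * (?I / ?K) - q * (?H / ?J)))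
      - q / (q - 1) * 1) w"
    unfolding Omega1_def powr_normalize f_def m_def
    by (intro acts_intros acts_F0[OF rect w] acts_Fminus[OF rect w] acts_K[OF w_homog[OF rect w]])
  also have "1 / ?H * (q * (f * (?H / ?J)) + (q - 1) * (m * (?H / ?J))
      + 1 / (q - 1) * (?K * q * (?K / ?I * (?H / ?J)) + ?H * ?K * q * (?I / ?K) - q * (?H / ?J)))
      - q / (q - 1) * 1 = (q * (?K * ?K) / (q ^ \<alpha> * q ^ \<rho>) + q ^ \<alpha> - q - 1) / (q - 1)"
    by (rule Omega1_coefficient[OF nz(1-4) nz(5) nz(5) nz(5) nz(5)])
      (simp_all only: f_def m_def sqrt_powers)
  finally show ?thesis by (simp only: sqrt_powers)
qed

lemma acts_Omega2: "acts Omega2 ((q * q ^ h / (q ^ \<rho> * q ^ \<beta>) + q ^ \<beta> - q - 1) / (q - 1)) w"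
proof -
  let ?H = "q powr (real h / 2)" and ?K = "q powr (real k / 2)"
  let ?I = "q ^ i" and ?J = "q ^ j"
  define f where "f = (q ^ k * q ^ j / (q ^ \<rho> * q ^ i) - q ^ j - q ^ k / q ^ i + 1) / (q - 1)"
  define p where "p = (q ^ h * q ^ k / q ^ i * q * (1 / q ^ (\<rho> + \<beta>) - 1 / q ^ Suc j)
      - q ^ k / (q ^ \<rho> * q ^ i) * (q ^ Suc j - q ^ (\<rho> + \<beta>))) / (q - 1)\<^sup>2
    - (q ^ h * q ^ k / (q ^ i * q ^ j) - q ^ k / q ^ i) / (q - 1)"
  have nz: "q \<noteq> 0" "q - 1 \<noteq> 0" "?H \<noteq> 0" "?K \<noteq> 0" "q ^ n \<noteq> 0" for n
    using q_ge_2 by auto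
  have "acts Omega2 (1 / ?K * (q * (f * (?I / ?K)) + (q - 1) * (p * (?I / ?K))
      + 1 / (q - 1) * (?H * q * (?I / ?K * (?J / ?H)) + ?H * ?K * q * (?H / ?J) - q * (?I / ?K)))
      - q / (q - 1) * 1) w"
    unfolding Omega2_def powr_normalize f_def p_def
    by (intro acts_intros acts_F0[OF rect w] acts_Fplus[OF rect w] acts_K[OF w_homog[OF rect w]])
  also have "1 / ?K * (q * (f * (?I / ?K)) + (q - 1) * (p * (?I / ?K))
      + 1 / (q - 1) * (?H * q * (?I / ?K * (?J / ?H)) + ?H * ?K * q * (?H / ?J) - q * (?I / ?K)))
      - q / (q - 1) * 1 = (q * (?H * ?H) / (q ^ \<rho> * q ^ \<beta>) + q ^ \<beta> - q - 1) / (q - 1)"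
    by (rule Omega2_coefficient[OF nz(1-4) nz(5) nz(5) nz(5) nz(5)])
      (simp_all only: f_def p_def sqrt_powers power_add power_Suc)
  finally show ?thesis by (simp only: sqrt_powers)
qed

lemma acts_Ymat: "acts Ymat (q ^ h * q ^ k / (q ^ i * q ^ j) + q ^ i * q ^ j - 1 + 1 / q) w"
proof -
  let ?H = "q powr (real h / 2)" and ?K = "q powr (real k / 2)"
  have "acts Ymat (?H * ?K * (?K / q ^ i * (?H / q ^ j) + q ^ i / ?K * (q ^ j / ?H)) - 1 / q * (q - 1) * 1) w"
    unfolding Ymat_def powr_normalize by (intro acts_intros acts_K[OF w_homog[OF rect w]])
  also have "?H * ?K * (?K / q ^ i * (?H / q ^ j) + q ^ i / ?K * (q ^ j / ?H)) - 1 / q * (q - 1) * 1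
      = (?H * ?H) * (?K * ?K) / (q ^ i * q ^ j) + q ^ i * q ^ j - 1 + 1 / q"
    using q_ge_2 by (simp add: field_simps)
  finally show ?thesis by (simp only: sqrt_powers)
qed

lemma acts_K1inv_K2: "acts (K1inv ** K2) (q ^ i * q ^ j / (q powr (real h / 2) * q powr (real k / 2))) w"
  using acts_mult[OF acts_K(2,3)[OF w_homog[OF rect w]]] by (simp add: mult.commute)

end

end

text \<open>Both sides are linear in \<open>s1\<close> and \<open>s2\<close>, the scalars of \<open>(q - 1) * Omega1 + (q + 1)\<close> and
  \<open>(q - 1) * Omega2 + (q + 1)\<close>; the terms without them cancel because the last summand in the
  definition of \<open>G\<close> is \<open>q + 1\<close> times the sum \<open>t1 + t2\<close> of their coefficients.  Here \<open>c\<^sup>2\<close> stands for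
  \<open>q\<^sup>h\<^sup>+\<^sup>k\<close>, and \<open>L\<close> for \<open>q\<close> to the power \<open>i + j\<close>.\<close>

lemma G_coefficient:
  fixes q c L s1 s2 \<kappa> y :: real
  assumes nz: "q \<noteq> 0" "q - 1 \<noteq> 0" "c \<noteq> 0" "L \<noteq> 0"
    and y: "y = c * c / L + L - 1 + 1 / q"
  shows "- (1 / (q - 1) * (c / q * ((q * (L / c * y) - c * (q + 1) * 1) * ((s1 - q - 1) / (q - 1)))
        + \<kappa> / q * ((q * y - c * (q + 1) * (L / c)) * ((s2 - q - 1) / (q - 1)))))
      - (q + 1) * (1 / (q - 1)\<^sup>2) * ((c * (L / c) + \<kappa> * 1) * y - c / q * (q + 1) * (\<kappa> * (L / c) + c * 1))
    = 1 / (q - 1) * (s1 * (L / q * ((c * c / L - 1) / (q - 1)) - L * ((L - 1) / (q - 1)))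
        - s2 * (\<kappa> * ((c * c / L - 1) / (q - 1)) - \<kappa> / q * ((L - 1) / (q - 1))))"
proof -
  define d where "d = q - 1"
  define t1 where "t1 = L * y - c * c * (q + 1) / q"
  define t2 where "t2 = \<kappa> * y - \<kappa> * (q + 1) * L / q"
  have d: "q - 1 = d" "d \<noteq> 0" using nz by (simp_all add: d_def)
  have p1: "c / q * ((q * (L / c * y) - c * (q + 1) * 1) * z) = t1 * z" for z
    using nz by (simp add: t1_def field_simps)
  have p2: "\<kappa> / q * ((q * y - c * (q + 1) * (L / c)) * z) = t2 * z" for z
    using nz by (simp add: t2_def field_simps)
  have p3: "(c * (L / c) + \<kappa> * 1) * y - c / q * (q + 1) * (\<kappa> * (L / c) + c * 1) = t1 + t2"
    using nz by (simp add: t1_def t2_def field_simps)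
  have e1: "L / q * (c * c / L - 1) - L * (L - 1) = - t1"
    using nz by (simp add: t1_def y field_simps)
  have e2: "\<kappa> * (c * c / L - 1) - \<kappa> / q * (L - 1) = t2"
    using nz by (simp add: t2_def y field_simps)
  have "- (1 / d * (t1 * ((s1 - q - 1) / d) + t2 * ((s2 - q - 1) / d))) - (q + 1) * (1 / d\<^sup>2) * (t1 + t2)
      = 1 / d * (s1 * (- t1 / d) - s2 * (t2 / d))"
    using d(2) by (simp add: field_simps power2_eq_square)
  also have "- t1 / d = L / q * ((c * c / L - 1) / d) - L * ((L - 1) / d)"
    unfolding e1[symmetric] by (simp only: times_divide_eq_right diff_divide_distrib[symmetric])
  also have "t2 / d = \<kappa> * ((c * c / L - 1) / d) - \<kappa> / q * ((L - 1) / d)"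
    unfolding e2[symmetric] by (simp only: times_divide_eq_right diff_divide_distrib[symmetric])
  finally show ?thesis unfolding p1 p2 p3 d(1) .
qed

context typed_module
begin

context
  fixes i j :: nat and w :: "complex^'v set"
  assumes rect: "in_rectangle i j" and w: "w \<in> weight_space W i j"
begin

lemma acts_Pmat:
  "acts Pmat (q * (1 / (q - 1)\<^sup>2) * ((q ^ h * q ^ k / (q ^ i * q ^ j) + q ^ i * q ^ j - 1 + 1 / q)\<^sup>2
    - q ^ h * q ^ k / q\<^sup>2 * (q + 1)\<^sup>2)) w"
proof -
  let ?y = "q ^ h * q ^ k / (q ^ i * q ^ j) + q ^ i * q ^ j - 1 + 1 / q"
  have "acts Pmat (q * (1 / (q - 1)\<^sup>2) * (?y * ?y - q ^ h * q ^ k / q\<^sup>2 * (q + 1)\<^sup>2 * 1)) w"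
    unfolding Pmat_def powr_normalize
    by (intro acts_intros acts_Ymat[OF rect w] acts_K(5)[OF w_homog[OF rect w]])
  then show ?thesis by (simp add: power2_eq_square)
qed

lemma acts_Omega:
  "acts Omega (- (q ^ i * q ^ j / q * (q * q ^ k / (q ^ \<alpha> * q ^ \<rho>) + q ^ \<alpha>))
    - q ^ k / q * (q * q ^ h / (q ^ \<rho> * q ^ \<beta>) + q ^ \<beta>)) w"
proof -
  let ?c = "q powr (real h / 2) * q powr (real k / 2)" and ?L = "q ^ i * q ^ j"
  let ?s1 = "q * q ^ k / (q ^ \<alpha> * q ^ \<rho>) + q ^ \<alpha>" and ?s2 = "q * q ^ h / (q ^ \<rho> * q ^ \<beta>) + q ^ \<beta>"
  have "acts Omega (- (?c / q * (?L / ?c * ((q - 1) * ((?s1 - q - 1) / (q - 1)) + (q + 1) * 1)))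
      - q ^ k / q * ((q - 1) * ((?s2 - q - 1) / (q - 1)) + (q + 1) * 1)) w"
    unfolding Omega_def powr_normalize
    by (intro acts_intros acts_Omega1[OF rect w] acts_Omega2[OF rect w] acts_K1inv_K2[OF rect w]
        acts_K(5)[OF w_homog[OF rect w]])
  also have "- (?c / q * (?L / ?c * ((q - 1) * ((?s1 - q - 1) / (q - 1)) + (q + 1) * 1)))
      - q ^ k / q * ((q - 1) * ((?s2 - q - 1) / (q - 1)) + (q + 1) * 1)
    = - (?L / q * ?s1) - q ^ k / q * ?s2"
    using q_ge_2 by simp
  finally show ?thesis .
qed

lemma acts_G:
  "acts G (1 / (q - 1) *
    ((q * q ^ k / (q ^ \<alpha> * q ^ \<rho>) + q ^ \<alpha>)
        * (q ^ i * q ^ j / q * ((q ^ h * q ^ k / (q ^ i * q ^ j) - 1) / (q - 1))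
           - q ^ i * q ^ j * ((q ^ i * q ^ j - 1) / (q - 1)))
      - (q * q ^ h / (q ^ \<rho> * q ^ \<beta>) + q ^ \<beta>)
        * (q ^ k * ((q ^ h * q ^ k / (q ^ i * q ^ j) - 1) / (q - 1))
           - q ^ k / q * ((q ^ i * q ^ j - 1) / (q - 1))))) w"
proof -
  let ?c = "q powr (real h / 2) * q powr (real k / 2)" and ?L = "q ^ i * q ^ j"
  let ?s1 = "q * q ^ k / (q ^ \<alpha> * q ^ \<rho>) + q ^ \<alpha>" and ?s2 = "q * q ^ h / (q ^ \<rho> * q ^ \<beta>) + q ^ \<beta>"
  let ?y = "q ^ h * q ^ k / ?L + ?L - 1 + 1 / q"
  have nz: "q \<noteq> 0" "q - 1 \<noteq> 0" "?c \<noteq> 0" "?L \<noteq> 0" using q_ge_2 by auto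
  have c: "?c * ?c = q ^ h * q ^ k" using sqrt_powers by (metis mult.assoc mult.left_commute)
  have "acts G (- (1 / (q - 1) * (?c / q * ((q * (?L / ?c * ?y) - ?c * (q + 1) * 1) * ((?s1 - q - 1) / (q - 1)))
        + q ^ k / q * ((q * ?y - ?c * (q + 1) * (?L / ?c)) * ((?s2 - q - 1) / (q - 1)))))
      - (q + 1) * (1 / (q - 1)\<^sup>2) * ((?c * (?L / ?c) + q ^ k * 1) * ?y
        - ?c / q * (q + 1) * (q ^ k * (?L / ?c) + ?c * 1))) w"
    unfolding G_def powr_normalize
    by (intro acts_intros acts_Omega1[OF rect w] acts_Omega2[OF rect w] acts_K1inv_K2[OF rect w]
        acts_Ymat[OF rect w] acts_K(5)[OF w_homog[OF rect w]])
  also note G_coefficient[OF nz, of ?y ?s1 "q ^ k" ?s2, unfolded c, OF refl]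
  finally show ?thesis .
qed

lemma acts_Gstar: "acts Gstar (q ^ k * (q ^ i * q ^ j) / q ^ \<rho> / q * (q + 1)) w"
proof -
  let ?H = "q powr (real h / 2)" and ?K = "q powr (real k / 2)"
  have "acts Gstar (?H * ?K * q ^ k / q * (q + 1) * (1 / q ^ \<rho> * (q ^ i / ?K) * (q ^ j / ?H))) w"
    unfolding Gstar_def powr_normalize
    by (intro acts_intros acts_Omega0[OF rect w] acts_K[OF w_homog[OF rect w]])
  also have "?H * ?K * q ^ k / q * (q + 1) * (1 / q ^ \<rho> * (q ^ i / ?K) * (q ^ j / ?H))
      = q ^ k * (q ^ i * q ^ j) / q ^ \<rho> / q * (q + 1)"
    using q_ge_2 by (simp add: field_simps)
  finally show ?thesis .
qed

end

lemma invariant_with_eigenvalue_weight_space: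
  assumes "\<And>w. w \<in> weight_space W i j \<Longrightarrow> acts A \<theta> w"
  shows "invariant_with_eigenvalue A (weight_space W i j) \<theta>"
  using assms scaleR_mem[OF weight_space_subspace[OF submodule]]
  by (simp add: invariant_with_eigenvalue_def acts_def of_real_scale_eq_scaleR)

end

theorem theorem7p4:
  fixes scale :: "'f::{field,finite} \<Rightarrow> 'v::{ab_group_add,finite} \<Rightarrow> 'v"
    and y :: "'v set" and h k \<alpha> \<beta> \<rho> i j l :: nat and q :: real
    and W S :: "(complex^'v set) set"
  assumes "fixed_subspace scale q y h k"
    and "fixed_subspace.irreducible_H_module scale q y h k W"
    and "fixed_subspace.has_type scale y h k W \<alpha> \<beta> \<rho>"
    and "\<alpha> \<le> i" and "i \<le> k - \<rho> - \<alpha>"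
    and "\<rho> + \<beta> \<le> j" and "j \<le> h - \<beta>"
    and "l = i + j"
    and "S = fixed_subspace.Estar_image scale y i j W"
  shows
    "invariant_with_eigenvalue (fixed_subspace.Ymat scale q y h k) S
       (q powr (real h + real k - real l) + q powr real l - 1 + q powr (-1)) \<and>
     invariant_with_eigenvalue (fixed_subspace.Pmat scale q y h k) S
       (q * (q - 1) powr (-2) *
         ((q powr (real h + real k - real l) + q powr real l - 1 + q powr (-1))\<^sup>2
          - q powr (real h + real k - 2) * (q + 1)\<^sup>2)) \<and>
     invariant_with_eigenvalue (fixed_subspace.Omega scale q y h k) S
       (- (q powr (real h + real k - real \<rho> - real \<beta>) + q powr (real k + real \<beta> - 1)
           + q powr (real k + real l - real \<rho> - real \<alpha>) + q powr (real l + real \<alpha> - 1))) \<and>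
     invariant_with_eigenvalue (fixed_subspace.G scale q y h k) S
       ((q - 1) powr (-1) *
         ((q powr (real k - real \<rho> - real \<alpha> + 1) + q powr real \<alpha>) *
            (q powr (real l - 1) * qint q (int h + int k - int l)
             - q powr real l * qint q (int l))
          - (q powr (real h - real \<rho> - real \<beta> + 1) + q powr real \<beta>) *
            (q powr real k * qint q (int h + int k - int l)
             - q powr (real k - 1) * qint q (int l)))) \<and>
     invariant_with_eigenvalue (fixed_subspace.Gstar scale q y h k) S
       (q powr (real k + real l - real \<rho> - 1) * (q + 1))"
proof -
  interpret typed_module scale q y h k W \<alpha> \<beta> \<rho>
    using assms(1-3) by (intro typed_module.intro typed_module_axioms.intro)
  have rect: "in_rectangle i j" using assms(4-7) by blast
  have S: "S = weight_space W i j"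
    using assms(9) Estar_image_eq_weight_space[OF submodule] by simp
  have q: "q > 0" "q - 1 > 0" using q_ge_2 by auto
  have l: "q ^ l = q ^ i * q ^ j" using assms(8) by (simp only: power_add)
  have p: "q powr real n = q ^ n" for n using q by (simp add: powr_realpow)
  have ql: "qint q (int l) = (q ^ i * q ^ j - 1) / (q - 1)"
    "qint q (int h + int k - int l) = (q ^ h * q ^ k / (q ^ i * q ^ j) - 1) / (q - 1)"
    by (simp_all add: qint_def powr_diff powr_add p l)
  have N: "q powr (real h + real k - real l) = q ^ h * q ^ k / (q ^ i * q ^ j)"
    by (simp add: powr_diff powr_add p l)
  have s1: "q powr (real k - real \<rho> - real \<alpha> + 1) = q * q ^ k / (q ^ \<alpha> * q ^ \<rho>)"
    using q by (simp add: powr_diff powr_add p mult_ac)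
  have s2: "q powr (real h - real \<rho> - real \<beta> + 1) = q * q ^ h / (q ^ \<rho> * q ^ \<beta>)"
    using q by (simp add: powr_diff powr_add p mult_ac)
  have om: "- (q powr (real h + real k - real \<rho> - real \<beta>) + q powr (real k + real \<beta> - 1)
           + q powr (real k + real l - real \<rho> - real \<alpha>) + q powr (real l + real \<alpha> - 1))
    = - (q ^ i * q ^ j / q * (q * q ^ k / (q ^ \<alpha> * q ^ \<rho>) + q ^ \<alpha>))
      - q ^ k / q * (q * q ^ h / (q ^ \<rho> * q ^ \<beta>) + q ^ \<beta>)"
    using q by (simp add: powr_diff powr_add p l field_simps)
  have gs: "q powr (real k + real l - real \<rho> - 1) * (q + 1) = q ^ k * (q ^ i * q ^ j) / q ^ \<rho> / q * (q + 1)"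
    using q by (simp add: powr_diff powr_add p l)
  have l1: "q powr (real l - 1) = q ^ i * q ^ j / q" using q by (simp add: powr_diff p l)
  show ?thesis
    unfolding S om gs
    unfolding s1 s2 ql N l1 powr_normalize l
    by (intro conjI invariant_with_eigenvalue_weight_space acts_Ymat[OF rect] acts_Pmat[OF rect]
        acts_Omega[OF rect] acts_G[OF rect] acts_Gstar[OF rect])
qed

end
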